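(* Let $G$ be a finite simple graph that is not complete. Let $\Delta_G$ be the set of all minimal separators of $G$ and let $\Delta_G^* := \{S \in \Delta_G \mid td(G) = |S| + td(G \setminus S)\}$. Then there exists $S \in \Delta_G^*$ with $|S| \le 2\,tw(G)$.
   Context: For $S\subseteq V(G)$, $G\setminus S$ denotes the subgraph induced by $V(G)\setminus S$. For vertices $a,b$, a set $S\subseteq V(G)\setminus\{a,b\}$ is an $a$-$b$ separator if $a$ and $b$ lie in different connected components of $G\setminus S$; it is a minimal $a$-$b$ separator if no proper subset of $S$ is an $a$-$b$ separator. $S$ is a minimal separator of $G$ if it is a minimal $a$-$b$ separator for some $a,b\in V(G)$. A treedepth decomposition of $G$ is a rooted forest $T$ with $V(T)=V(G)$ such that for every edge $uv$ of $G$, one of $u,v$ is an ancestor of the other in $T$. The height of a rooted forest is the maximum number of vertices on a root-to-leaf path. The treedepth $td(G)$ is the minimum height of a treedepth decomposition of $G$. The treewidth $tw(G)$ is the minimum, over all tree decompositions of $G$, of the maximum bag size minus one. *)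

theory Defs
  imports "Graph_Theory.Graph_Theory"
begin

text \<open>
  A finite simple graph is a digraph satisfying the locale \<open>graph\<close> (finite, symmetric, without
  loops and parallel arcs): an edge is a pair of opposite arcs. In a symmetric digraph the strongly
  connected components are exactly the connected components.
\<close>

definition complete_graph :: "('a, 'b) pre_digraph \<Rightarrow> bool" where
  "complete_graph G \<longleftrightarrow> (\<exists>n. K\<^bsub>n\<^esub> G)"

definition delete_verts :: "('a, 'b) pre_digraph \<Rightarrow> 'a set \<Rightarrow> ('a, 'b) pre_digraph" where
  "delete_verts G S = G \<restriction> (verts G - S)"


subsection \<open>Minimal separators\<close>

definition separator :: "('a, 'b) pre_digraph \<Rightarrow> 'a \<Rightarrow> 'a \<Rightarrow> 'a set \<Rightarrow> bool" where
  "separator G a b S \<longleftrightarrow>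
     a \<in> verts G \<and> b \<in> verts G \<and> S \<subseteq> verts G - {a, b} \<and>
     (\<exists>C \<in> pre_digraph.sccs_verts (delete_verts G S).
      \<exists>D \<in> pre_digraph.sccs_verts (delete_verts G S). a \<in> C \<and> b \<in> D \<and> C \<noteq> D)"

definition minimal_ab_separator :: "('a, 'b) pre_digraph \<Rightarrow> 'a \<Rightarrow> 'a \<Rightarrow> 'a set \<Rightarrow> bool" where
  "minimal_ab_separator G a b S \<longleftrightarrow> separator G a b S \<and> (\<forall>S'. S' \<subset> S \<longrightarrow> \<not> separator G a b S')"

definition minimal_separators :: "('a, 'b) pre_digraph \<Rightarrow> 'a set set" where
  "minimal_separators G = {S. \<exists>a \<in> verts G. \<exists>b \<in> verts G. minimal_ab_separator G a b S}"


subsection \<open>Treedepth\<close>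

text \<open>
  A rooted forest is represented by its arcs from parents to children. The library's \<open>forest\<close>
  only excludes directed cycles, so the in-degree bound is what makes the parent unique. Roots are
  the vertices of in-degree 0, leaves those of out-degree 0, and \<open>u\<close> is an ancestor of \<open>v\<close> iff
  \<open>v\<close> is reachable from \<open>u\<close>.
\<close>

definition rooted_forest :: "'a pair_pre_digraph \<Rightarrow> bool" where
  "rooted_forest F \<longleftrightarrow>
     pair_fin_digraph F \<and> forest (with_proj F) \<and> (\<forall>v \<in> pverts F. in_degree (with_proj F) v \<le> 1)"

text \<open>On \<open>nat\<close>, the supremum of a finite nonempty set is its maximum; the empty forest has height 0.\<close>

definition forest_height :: "'a pair_pre_digraph \<Rightarrow> nat" where
  "forest_height F =
     Sup {length (pre_digraph.awalk_verts (with_proj F) r p) | r p l.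
       in_degree (with_proj F) r = 0 \<and> out_degree (with_proj F) l = 0 \<and>
       pre_digraph.apath (with_proj F) r p l}"

definition treedepth_decomposition :: "('a, 'b) pre_digraph \<Rightarrow> 'a pair_pre_digraph \<Rightarrow> bool" where
  "treedepth_decomposition G F \<longleftrightarrow>
     rooted_forest F \<and> pverts F = verts G \<and>
     (\<forall>u v. u \<rightarrow>\<^bsub>G\<^esub> v \<longrightarrow> u \<rightarrow>\<^sup>*\<^bsub>with_proj F\<^esub> v \<or> v \<rightarrow>\<^sup>*\<^bsub>with_proj F\<^esub> u)"

definition treedepth :: "('a, 'b) pre_digraph \<Rightarrow> nat" where
  "treedepth G = (LEAST h. \<exists>F. treedepth_decomposition G F \<and> forest_height F = h)"


subsection \<open>Treewidth\<close>

text \<open>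
  The library's \<open>tree\<close> is meant for oriented graphs: in a symmetric digraph every edge gives a
  directed cycle of length 2. A cycle of the undirected graph is a directed cycle of length at
  least 3.
\<close>

definition undirected_tree :: "'a pair_pre_digraph \<Rightarrow> bool" where
  "undirected_tree T \<longleftrightarrow>
     pair_graph T \<and> connected (with_proj T) \<and>
     \<not> (\<exists>p. pre_digraph.cycle (with_proj T) p \<and> 3 \<le> length p)"

text \<open>
  Since every finite tree has a copy on natural numbers, it is no restriction to take the nodes of
  the decomposition tree from \<open>nat\<close>. Note that \<open>connected\<close> includes nonemptiness.
\<close>

definition tree_decomposition ::
    "('a, 'b) pre_digraph \<Rightarrow> nat pair_pre_digraph \<Rightarrow> (nat \<Rightarrow> 'a set) \<Rightarrow> bool" where
  "tree_decomposition G T B \<longleftrightarrow>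
     undirected_tree T \<and>
     (\<Union>t \<in> pverts T. B t) = verts G \<and>
     (\<forall>u v. u \<rightarrow>\<^bsub>G\<^esub> v \<longrightarrow> (\<exists>t \<in> pverts T. u \<in> B t \<and> v \<in> B t)) \<and>
     (\<forall>v \<in> verts G. connected (with_proj T \<restriction> {t \<in> pverts T. v \<in> B t}))"

text \<open>The subtraction is truncated only if all bags are empty, i.e. for the graph without vertices.\<close>

definition decomposition_width :: "nat pair_pre_digraph \<Rightarrow> (nat \<Rightarrow> 'a set) \<Rightarrow> nat" where
  "decomposition_width T B = Max ((\<lambda>t. card (B t)) ` pverts T) - 1"

definition treewidth :: "('a, 'b) pre_digraph \<Rightarrow> nat" where
  "treewidth G = (LEAST w. \<exists>T B. tree_decomposition G T B \<and> decomposition_width T B = w)"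


subsection \<open>Minimal separators that are optimal for treedepth\<close>

definition optimal_minimal_separators :: "('a, 'b) pre_digraph \<Rightarrow> 'a set set" where
  "optimal_minimal_separators G =
     {S \<in> minimal_separators G. treedepth G = card S + treedepth (delete_verts G S)}"

end

theory Submission
  imports Defs
begin

text \<open>
  Call \<open>P\<close> optimal if \<open>td(G) = |P| + td(G - P)\<close>. Every subset of an optimal set is optimal, so each
  optimal set that disconnects \<open>G\<close> contains an optimal minimal separator. Deleting roots of optimal
  treedepth decompositions until the rest is disconnected yields some optimal minimal separator \<open>S\<close>.
  If \<open>|S| > 2k\<close> with \<open>k = tw(G)\<close>, some bag \<open>B\<close> of an optimal tree decomposition disconnects \<open>G\<close>
  and satisfies \<open>|C \<inter> S| \<le> |S| - |B|\<close> for every component \<open>C\<close> of \<open>G - B\<close>: otherwise each bag \<open>B\<close>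
  has a violating component or a connected complement, and since \<open>|B| \<le> k + 1\<close> and \<open>|S| > 2k\<close> these
  sets touch pairwise and form a bramble that no bag covers. For such a bag,
  \<open>td(G) \<le> |B| + max\<^sub>C (|C \<inter> S| + td(C - S)) \<le> |S| + td(G - S) = td(G)\<close>, so \<open>B\<close> is
  optimal and contains an optimal minimal separator, of size at most \<open>k + 1 \<le> 2k\<close>.
\<close>

section \<open>Connectedness in a relation\<close>

definition connected_in :: "'a rel \<Rightarrow> 'a set \<Rightarrow> bool" where
  "connected_in r X \<longleftrightarrow> X \<noteq> {} \<and> (\<forall>u\<in>X. \<forall>v\<in>X. (u, v) \<in> rtrancl_on X r)"

definition no_edge :: "'a rel \<Rightarrow> 'a set \<Rightarrow> 'a set \<Rightarrow> bool" where
  "no_edge r A B \<longleftrightarrow> (\<forall>a\<in>A. \<forall>b\<in>B. (a, b) \<notin> r \<and> (b, a) \<notin> r)"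

definition component_in :: "'a rel \<Rightarrow> 'a set \<Rightarrow> 'a set \<Rightarrow> bool" where
  "component_in r X C \<longleftrightarrow> C \<subseteq> X \<and> connected_in r C \<and> no_edge r C (X - C)"

lemma no_edge_sym: "no_edge r A B \<Longrightarrow> no_edge r B A"
  by (auto simp: no_edge_def)

lemma no_edge_mono: "no_edge r A B \<Longrightarrow> A' \<subseteq> A \<Longrightarrow> B' \<subseteq> B \<Longrightarrow> no_edge r A' B'"
  by (auto simp: no_edge_def)

lemma rtrancl_on_no_edge:
  assumes "(u, v) \<in> rtrancl_on X r" "u \<in> A" "X \<subseteq> A \<union> B" "no_edge r A B"
  shows "v \<in> A"
  using assms by (induction rule: rtrancl_on_induct) (auto simp: no_edge_def)

lemma connected_in_split:
  assumes "connected_in r X" "X \<subseteq> A \<union> B" "no_edge r A B"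
  shows "X \<subseteq> A \<or> X \<subseteq> B"
proof (rule ccontr)
  assume "\<not> ?thesis"
  then obtain u v where uv: "u \<in> X" "u \<notin> B" "v \<in> X" "v \<notin> A" by blast
  then have "(u, v) \<in> rtrancl_on X r" "u \<in> A"
    using assms by (auto simp: connected_in_def)
  then show False using rtrancl_on_no_edge assms uv by metis
qed

text \<open>The vertices reachable from \<open>u\<close> inside \<open>X\<close> are closed under
  arcs within \<open>X\<close>; symmetry of \<open>r\<close> then excludes arcs in the opposite
  direction too.\<close>

lemma not_reachable_split:
  assumes "sym r" "u \<in> X" "v \<in> X" "(u, v) \<notin> rtrancl_on X r"
  obtains A where "u \<in> A" "v \<in> X - A" "A \<subseteq> X" "no_edge r A (X - A)"
proof
  let ?A = "{y. (u, y) \<in> rtrancl_on X r}"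
  show "u \<in> ?A" "v \<in> X - ?A" using assms by auto
  show "?A \<subseteq> X" by (auto dest: in_rtrancl_on_in_F)
  have "(a, b) \<notin> r" if "a \<in> ?A" "b \<in> X - ?A" for a b
    using that by (auto intro: rtrancl_on_into_rtrancl_on)
  then show "no_edge r ?A (X - ?A)" using assms(1) unfolding no_edge_def by (meson symE)
qed

lemma connected_inI:
  assumes "sym r" "X \<noteq> {}"
    and "\<And>A. A \<subseteq> X \<Longrightarrow> A \<noteq> {} \<Longrightarrow> no_edge r A (X - A) \<Longrightarrow> A = X"
  shows "connected_in r X"
proof (rule ccontr)
  assume "\<not> ?thesis"
  then obtain u v where "u \<in> X" "v \<in> X" "(u, v) \<notin> rtrancl_on X r"
    using assms(2) by (auto simp: connected_in_def)
  from not_reachable_split[OF assms(1) this] assms(3) show False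
    by (metis DiffE empty_iff)
qed

lemma not_connected_in_split:
  assumes "sym r" "X \<noteq> {}" "\<not> connected_in r X"
  obtains A where "A \<subseteq> X" "A \<noteq> {}" "A \<noteq> X" "no_edge r A (X - A)"
  using connected_inI[OF assms(1,2)] assms(3) by blast

section \<open>Treedepth by deleting vertices and splitting\<close>

text \<open>This is the recursive description of treedepth: a root costs one level, and parts
  without edges between them stand side by side at no extra cost. The empty set takes every
  \<open>h\<close>, so \<open>h\<close> is an upper bound rather than an exact height.\<close>

inductive td_le :: "'a rel \<Rightarrow> 'a set \<Rightarrow> nat \<Rightarrow> bool" for r where
  td_empty: "td_le r {} h"
| td_remove: "v \<in> X \<Longrightarrow> td_le r (X - {v}) h \<Longrightarrow> td_le r X (Suc h)"
| td_split: "td_le r A h \<Longrightarrow> td_le r B h \<Longrightarrow> A \<inter> B = {} \<Longrightarrow> no_edge r A B \<Longrightarrow> td_le r (A \<union> B) h"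

lemma td_le_mono: "td_le r X h \<Longrightarrow> h \<le> h' \<Longrightarrow> td_le r X h'"
proof (induction arbitrary: h' rule: td_le.induct)
  case (td_remove v X h)
  then obtain h'' where "h' = Suc h''" "h \<le> h''" by (cases h') auto
  with td_remove show ?case by (auto intro: td_le.td_remove)
qed (auto intro: td_le.intros)

text \<open>The derivation for \<open>X\<close> is intersected with \<open>Y\<close>; the removal of
  a vertex outside \<open>Y\<close> is skipped, which only leaves slack in the height.\<close>

lemma td_le_subset: "td_le r X h \<Longrightarrow> Y \<subseteq> X \<Longrightarrow> td_le r Y h"
proof (induction arbitrary: Y rule: td_le.induct)
  case (td_remove v X h)
  show ?case
  proof (cases "v \<in> Y")
    case True
    moreover have "Y - {v} \<subseteq> X - {v}" using td_remove.prems by auto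
    ultimately show ?thesis using td_remove.IH by (intro td_le.td_remove[of v]) auto
  next
    case False
    then have "td_le r Y h" using td_remove by auto
    then show ?thesis by (rule td_le_mono) simp
  qed
next
  case (td_split A h B)
  have "td_le r ((Y \<inter> A) \<union> (Y \<inter> B)) h"
    using td_split no_edge_mono[of r A B "Y \<inter> A" "Y \<inter> B"]
    by (intro td_le.td_split) auto
  moreover have "(Y \<inter> A) \<union> (Y \<inter> B) = Y" using td_split by auto
  ultimately show ?case by simp
qed (auto intro: td_le.intros)

lemma td_le_add_card: "finite A \<Longrightarrow> td_le r (X - A) h \<Longrightarrow> td_le r X (h + card A)"
proof (induction A arbitrary: h rule: finite_induct)
  case (insert v A)
  have "td_le r (X - A) (Suc h)"
  proof (cases "v \<in> X - A")
    case True
    then show ?thesis using insert.prems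
      by (intro td_remove[of v]) (auto simp: set_diff_eq elim!: back_subst[of "\<lambda>X. td_le r X h"])
  next
    case False
    then have "X - insert v A = X - A" by auto
    then show ?thesis using insert.prems by (auto intro: td_le_mono)
  qed
  from insert.IH[OF this] insert.hyps show ?case by simp
qed simp

lemma td_le_card: "finite X \<Longrightarrow> td_le r X (card X)"
  using td_le_add_card[of X r X 0] by (simp add: td_empty)

text \<open>If \<open>A\<close> has no edges to \<open>X - A\<close>, the components of both parts
  are components of \<open>X\<close>. Induction on \<open>X\<close> therefore assembles the bounds
  with \<open>td_split\<close>.\<close>

lemma td_le_components:
  assumes "sym r" "finite X" "\<And>C. component_in r X C \<Longrightarrow> td_le r C h"
  shows "td_le r X h"
  using assms(2,3)
proof (induction X rule: finite_psubset_induct)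
  case (psubset X)
  consider "X = {}" | "connected_in r X" | "X \<noteq> {}" "\<not> connected_in r X" by blast
  then show ?case
  proof cases
    case 1
    then show ?thesis by (simp add: td_empty)
  next
    case 2
    then show ?thesis using psubset.prems by (simp add: component_in_def no_edge_def)
  next
    case 3
    then obtain A where A: "A \<subseteq> X" "A \<noteq> {}" "A \<noteq> X" "no_edge r A (X - A)"
      using not_connected_in_split assms(1) by metis
    have "component_in r X C" if "component_in r A C \<or> component_in r (X - A) C" for C
      using that A unfolding component_in_def no_edge_def by blast
    then have "td_le r A h" "td_le r (X - A) h"
      using psubset.IH[of A] psubset.IH[of "X - A"] psubset.prems A by auto
    from td_split[OF this] A show ?thesis by (simp add: Un_absorb1)
  qed
qed

text \<open>When a connected set is split, one side is already the whole set, so the derivation must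
  come to a removal; the removed vertex acts as the root.\<close>

lemma td_le_connected:
  assumes "td_le r X h" "connected_in r X"
  shows "\<exists>v\<in>X. \<exists>h'. h = Suc h' \<and> td_le r (X - {v}) h'"
  using assms
proof (induction rule: td_le.induct)
  case (td_split A h B)
  then have "A \<union> B = A \<or> A \<union> B = B" using connected_in_split[of r "A \<union> B" A B] by auto
  then show ?case using td_split by metis
qed (auto simp: connected_in_def)

definition td :: "'a rel \<Rightarrow> 'a set \<Rightarrow> nat" where
  "td r X = (LEAST h. td_le r X h)"

lemma td_le_iff: "finite X \<Longrightarrow> td_le r X h \<longleftrightarrow> td r X \<le> h"
  unfolding td_def using td_le_card[of X r] by (metis LeastI Least_le td_le_mono)

lemma td_mono: "finite X \<Longrightarrow> Y \<subseteq> X \<Longrightarrow> td r Y \<le> td r X"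
  by (meson finite_subset le_refl td_le_iff td_le_subset)

lemma td_le_diff: "finite X \<Longrightarrow> A \<subseteq> X \<Longrightarrow> td r X \<le> card A + td r (X - A)"
  by (metis add.commute finite_Diff finite_subset order_refl td_le_add_card td_le_iff)

section \<open>Optimal vertex sets\<close>

definition td_optimal :: "'a rel \<Rightarrow> 'a set \<Rightarrow> 'a set \<Rightarrow> bool" where
  "td_optimal r V P \<longleftrightarrow> P \<subseteq> V \<and> td r V = card P + td r (V - P)"

text \<open>For \<open>A\<close> inside \<open>P\<close>, td(V) \<le> |A| + td(V - A) \<le> |A| + |P
  - A| + td(V - P) = td(V), so equality holds throughout.\<close>

lemma td_optimal_subset:
  assumes "finite V" "td_optimal r V P" "A \<subseteq> P"
  shows "td_optimal r V A"
proof -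
  have P: "P \<subseteq> V" "td r V = card P + td r (V - P)" "finite P"
    using assms by (auto simp: td_optimal_def finite_subset)
  have "(V - A) - (P - A) = V - P" using assms(3) by auto
  then have "td r (V - A) \<le> card (P - A) + td r (V - P)"
    using td_le_diff[of "V - A" "P - A" r] P assms by auto
  moreover have "card (P - A) + card A = card P"
    using P(3) assms(3) by (metis card_Diff_subset card_mono finite_subset le_add_diff_inverse2)
  moreover have "td r V \<le> card A + td r (V - A)"
    using td_le_diff[of V A r] P assms by auto
  ultimately show ?thesis using P assms(3) by (auto simp: td_optimal_def)
qed

text \<open>An optimal \<open>P\<close> of maximal size with nonempty rest works: if the rest were
  connected, its root could be moved into \<open>P\<close>. The non-adjacent pair ensures that this
  does not exhaust \<open>V\<close>, because it forces td(V) < |V|.\<close>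

lemma ex_optimal_disconnecting:
  assumes "finite V" "a \<in> V" "b \<in> V" "a \<noteq> b" "(a, b) \<notin> r" "(b, a) \<notin> r"
  obtains P where "td_optimal r V P" "V - P \<noteq> {}" "\<not> connected_in r (V - P)"
proof -
  let ?Q = "\<lambda>P. td_optimal r V P \<and> V - P \<noteq> {}"
  have "?Q {}" using assms by (auto simp: td_optimal_def)
  moreover have "\<forall>P. ?Q P \<longrightarrow> card P < Suc (card V)"
    using assms(1) by (simp add: td_optimal_def card_mono less_Suc_eq_le)
  ultimately obtain P where P: "?Q P" and max: "\<And>P'. ?Q P' \<Longrightarrow> card P' \<le> card P"
    using ex_has_greatest_nat[of ?Q "{}" card "Suc (card V)"] by metis
  have fin: "finite P" "P \<subseteq> V" using P assms(1) by (auto simp: td_optimal_def finite_subset)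
  have "\<not> connected_in r (V - P)"
  proof
    assume "connected_in r (V - P)"
    then obtain v h where v: "v \<in> V - P" "td r (V - P) = Suc h" "td_le r (V - P - {v}) h"
      using td_le_connected[of r "V - P" "td r (V - P)"] td_le_iff[of "V - P" r] assms(1) by auto
    have eq: "V - insert v P = V - P - {v}" by auto
    have "td r (V - insert v P) \<le> h" using v(3) assms(1) by (subst eq) (simp add: td_le_iff[symmetric])
    moreover have "td r V \<le> card (insert v P) + td r (V - insert v P)"
      using td_le_diff[of V "insert v P" r] fin v assms(1) by auto
    ultimately have "td_optimal r V (insert v P)"
      using P fin v by (auto simp: td_optimal_def)
    moreover have "card (insert v P) > card P" using v fin by simp
    \<comment> \<open>The enlarged set is optimal and bigger than the maximal \<open>P\<close>, so
      it can only fail the condition that something remains.\<close>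
    ultimately have "V - insert v P = {}" using max[of "insert v P"] by auto
    then have V: "V = insert v P" using fin v by auto
    have "td r V = card V" using P v(1,2) \<open>td_optimal r V (insert v P)\<close> V
      by (auto simp: td_optimal_def td_def intro: Least_eq_0 td_empty)
    \<comment> \<open>Non-adjacent \<open>a\<close> and \<open>b\<close> share one level; deleting
      all other vertices first gives td(V) \<le> |V| - 1, against td(V) = |V|.\<close>
    moreover have "td_le r ({a} \<union> {b}) 1"
      using assms td_le_card[of "{a}" r] td_le_card[of "{b}" r]
      by (intro td_split) (auto simp: no_edge_def)
    then have "td r (V - (V - {a, b})) \<le> 1"
      using assms by (subst td_le_iff[symmetric]) (auto simp: double_diff insert_commute)
    then have "td r V \<le> card (V - {a, b}) + 1"
      using td_le_diff[of V "V - {a, b}" r] assms(1) by simp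
    moreover have "card (V - {a, b}) + 2 = card V"
      using assms card_mono[of V "{a, b}"] by (subst card_Diff_subset) auto
    ultimately show False by simp
  qed
  with P that show ?thesis by blast
qed

section \<open>Brambles and tree decompositions\<close>

definition side :: "'a set \<Rightarrow> 'a rel \<Rightarrow> 'a \<Rightarrow> 'a \<Rightarrow> 'a set" where
  "side N T s t = {x. (s, x) \<in> rtrancl_on N (T - {(s, t), (t, s)})}"

text \<open>Acyclicity is expressed by every edge being a bridge: \<open>side N T s t\<close> is the
  part containing \<open>s\<close> once the edge between \<open>s\<close> and \<open>t\<close> is
  deleted.\<close>

definition tree_on :: "'a set \<Rightarrow> 'a rel \<Rightarrow> bool" where
  "tree_on N T \<longleftrightarrow> finite N \<and> connected_in T N \<and> sym T \<and> T \<subseteq> N \<times> N \<and>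
     (\<forall>(s, t)\<in>T. t \<notin> side N T s t)"

lemma side_subset: "side N T s t \<subseteq> N"
  by (auto simp: side_def dest: in_rtrancl_on_in_F)

text \<open>Only the arc \<open>(s, t)\<close> can leave the side of \<open>s\<close>; the other
  deleted arc \<open>(t, s)\<close> ends in \<open>s\<close> itself.\<close>

lemma
  assumes "tree_on N T" "(s, t) \<in> T"
  shows side_self: "s \<in> side N T s t"
    and side_step: "x \<in> side N T s t \<Longrightarrow> (x, y) \<in> T \<Longrightarrow> (x, y) \<noteq> (s, t) \<Longrightarrow> y \<in> side N T s t"
proof -
  show 1: "s \<in> side N T s t" using assms by (auto simp: tree_on_def side_def)
  assume "x \<in> side N T s t" "(x, y) \<in> T" "(x, y) \<noteq> (s, t)"
  then show "y \<in> side N T s t"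
    using 1 assms by (cases "(x, y) = (t, s)") (auto simp: tree_on_def side_def intro: rtrancl_on_into_rtrancl_on)
qed

text \<open>A common node would, by symmetry, yield a path from \<open>s\<close> to \<open>t\<close>
  avoiding the edge between them, although this edge is a bridge.\<close>

lemma side_disjoint:
  assumes "tree_on N T" "(s, t) \<in> T"
  shows "side N T s t \<inter> side N T t s = {}"
proof (rule ccontr)
  let ?R = "T - {(s, t), (t, s)}"
  assume "\<not> ?thesis"
  then obtain x where x: "(s, x) \<in> rtrancl_on N ?R" "(t, x) \<in> rtrancl_on N ?R"
    by (auto simp: side_def insert_commute)
  have "sym ?R" using assms by (auto simp: tree_on_def sym_def)
  then have "(x, t) \<in> rtrancl_on N ?R" using x(2) by (meson rtrancl_on_sym symE)
  then have "t \<in> side N T s t" using x(1) by (auto simp: side_def intro: rtrancl_on_trans)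
  then show False using assms by (auto simp: tree_on_def)
qed

lemma side_cover:
  assumes "tree_on N T" "(s, t) \<in> T"
  shows "N \<subseteq> side N T s t \<union> side N T t s"
proof
  have ts: "(t, s) \<in> T" using assms by (auto simp: tree_on_def dest: symD)
  fix x assume "x \<in> N"
  then have "(s, x) \<in> rtrancl_on N T" using assms by (auto simp: tree_on_def connected_in_def)
  then show "x \<in> side N T s t \<union> side N T t s"
  proof (induction rule: rtrancl_on_induct)
    case base
    then show ?case using side_self[OF assms] by simp
  next
    case (step y z)
    show ?case
      using step.IH step.hyps(2) side_step[OF assms, of y z] side_step[OF assms(1) ts, of y z]
        side_self[OF assms] side_self[OF assms(1) ts] by blast
  qed
qed

text \<open>The edge between \<open>s\<close> and \<open>t\<close> is the only one joining the two
  sides, and \<open>Z\<close> misses one of its ends, so a connected \<open>Z\<close> cannot meet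
  both sides.\<close>

lemma connected_in_side:
  assumes "tree_on N T" "(s, t) \<in> T" "connected_in T Z" "Z \<subseteq> N" "s \<notin> Z \<or> t \<notin> Z"
  shows "Z \<subseteq> side N T s t \<or> Z \<subseteq> side N T t s"
proof -
  let ?A = "Z \<inter> side N T s t" and ?B = "Z \<inter> side N T t s"
  have "(a, b) \<notin> T" if "a \<in> ?A" "b \<in> ?B" for a b
    using that side_step[OF assms(1,2), of a b] side_disjoint[OF assms(1,2)] assms(5) by blast
  then have "no_edge T ?A ?B"
    using assms(1) unfolding no_edge_def tree_on_def by (meson symE)
  then show ?thesis
    using connected_in_split[of T Z ?A ?B] assms side_cover[OF assms(1,2)] by blast
qed

text \<open>On a walk from \<open>t\<close> to a node of \<open>Z\<close>, the last departure from
  \<open>t\<close> enters the side of some neighbour \<open>s\<close>. Since \<open>Z\<close> is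
  connected and misses \<open>t\<close>, all of it lies there.\<close>

lemma tree_direction:
  assumes "tree_on N T" "t \<in> N" "connected_in T Z" "Z \<subseteq> N" "t \<notin> Z"
  shows "\<exists>s. (t, s) \<in> T \<and> Z \<subseteq> side N T s t"
proof -
  have sym: "(t, s) \<in> T \<Longrightarrow> (s, t) \<in> T" for s using assms by (auto simp: tree_on_def dest: symD)
  obtain x where x: "x \<in> Z" using assms by (auto simp: connected_in_def)
  have "(t, x) \<in> rtrancl_on N T" using assms x by (auto simp: tree_on_def connected_in_def)
  then have "x = t \<or> (\<exists>s. (t, s) \<in> T \<and> x \<in> side N T s t)"
  proof (induction rule: rtrancl_on_induct)
    case (step y z)
    show ?case
    proof (cases "y = t")
      case True
      then show ?thesis using step.hyps(2) side_self[OF assms(1) sym] by blast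
    next
      case False
      then obtain s where s: "(t, s) \<in> T" "y \<in> side N T s t" using step.IH by blast
      then show ?thesis using side_step[OF assms(1) sym, of s y z] step.hyps(2) by blast
    qed
  qed simp
  then obtain s where s: "(t, s) \<in> T" "x \<in> side N T s t" using x assms(5) by blast
  then have "Z \<subseteq> side N T s t"
    using connected_in_side[OF assms(1) s(1) assms(3,4)] side_disjoint[OF assms(1) s(1)] x assms(5)
    by blast
  with s show ?thesis by blast
qed

text \<open>
  Every node is sent one step towards the connected set that avoids it. An arc whose far side is
  smallest must be traversed back and forth, which puts two of the sets on opposite sides.
\<close>

lemma tree_no_avoiding_family:
  assumes "tree_on N T"
    and Z: "\<And>t. t \<in> N \<Longrightarrow> connected_in T (Z t) \<and> Z t \<subseteq> N \<and> t \<notin> Z t"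
    and meet: "\<And>s t. s \<in> N \<Longrightarrow> t \<in> N \<Longrightarrow> Z s \<inter> Z t \<noteq> {}"
  shows False
proof -
  have fin: "finite N" and ne: "N \<noteq> {}" and TN: "T \<subseteq> N \<times> N" and "sym T"
    using assms(1) by (auto simp: tree_on_def connected_in_def)
  have "\<forall>t\<in>N. \<exists>s. (t, s) \<in> T \<and> Z t \<subseteq> side N T s t"
    using tree_direction[OF assms(1)] Z by blast
  then obtain f where f: "\<And>t. t \<in> N \<Longrightarrow> (t, f t) \<in> T \<and> Z t \<subseteq> side N T (f t) t" by metis
  obtain t where t: "t \<in> N" "\<And>u. u \<in> N \<Longrightarrow> card (side N T (f t) t) \<le> card (side N T (f u) u)"
    using ex_min_if_finite[of "(\<lambda>t. card (side N T (f t) t)) ` N"] fin ne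
    by (smt (verit) finite_imageI image_iff image_is_empty linorder_not_le)
  let ?s = "f t" and ?u = "f (f t)"
  have s: "?s \<in> N" "(?s, t) \<in> T" using f[OF t(1)] TN \<open>sym T\<close> by (auto dest: symD)
  have u: "(?s, ?u) \<in> T" using f[OF s(1)] by simp
  \<comment> \<open>Stepping straight back would put \<open>Z t\<close> and \<open>Z ?s\<close> on
    opposite sides of one edge, although they meet.\<close>
  have "?u \<noteq> t"
    using f[OF t(1)] f[OF s(1)] meet[OF t(1) s(1)] side_disjoint[OF assms(1) s(2)] by (metis disjoint_iff subsetD)
  \<comment> \<open>A walk from \<open>?u\<close> that avoids the edge to \<open>?s\<close> never
    visits \<open>?s\<close>, so it cannot cross from \<open>?s\<close> to \<open>t\<close> either.
    The side at \<open>?u\<close> is thus nested in the side at \<open>?s\<close>, and properly so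
    because it misses \<open>?s\<close>; this contradicts the minimal choice of
    \<open>t\<close>.\<close>
  have "x \<in> side N T ?s t" if "x \<in> side N T ?u ?s" for x
    using that[unfolded side_def, simplified]
  proof (induction rule: rtrancl_on_induct)
    case base
    then show ?case
      using side_step[OF assms(1) s(2) side_self[OF assms(1) s(2)] u] \<open>?u \<noteq> t\<close> by simp
  next
    case (step y z)
    then have "y \<in> side N T ?u ?s" by (simp add: side_def)
    then have "y \<noteq> ?s"
      using side_disjoint[OF assms(1) u] side_self[OF assms(1) u] by blast
    then show ?case using step side_step[OF assms(1) s(2), of y z] by simp
  qed
  moreover have "?s \<in> side N T ?s t" by (rule side_self[OF assms(1) s(2)])
  moreover have "?s \<notin> side N T ?u ?s"
    using side_disjoint[OF assms(1) u] side_self[OF assms(1) u] by blast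
  ultimately have "side N T ?u ?s \<subset> side N T ?s t" by blast
  then have "card (side N T ?u ?s) < card (side N T ?s t)"
    using fin side_subset[of N T] by (meson finite_subset psubset_card_mono)
  then show False using t(2)[OF s(1)] by simp
qed

section \<open>Tree decompositions and brambles\<close>

definition tree_dec :: "'a rel \<Rightarrow> 'a set \<Rightarrow> 'n set \<Rightarrow> 'n rel \<Rightarrow> ('n \<Rightarrow> 'a set) \<Rightarrow> bool" where
  "tree_dec r V N T B \<longleftrightarrow> tree_on N T \<and> (\<Union>t\<in>N. B t) = V \<and>
     (\<forall>(u, v)\<in>r. \<exists>t\<in>N. u \<in> B t \<and> v \<in> B t) \<and>
     (\<forall>v\<in>V. connected_in T {t\<in>N. v \<in> B t})"

text \<open>A cut of these nodes sorts the vertices of \<open>C\<close> by the part that contains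
  their connected node set. Adjacent vertices share a bag and are sorted alike, so connectedness of
  \<open>C\<close> puts all of them in the same class, and the cut is trivial.\<close>

lemma tree_dec_connected_nodes:
  assumes "tree_dec r V N T B" "connected_in r C" "C \<subseteq> V"
  shows "connected_in T {t\<in>N. B t \<inter> C \<noteq> {}}"
proof (rule connected_inI)
  let ?Z = "{t\<in>N. B t \<inter> C \<noteq> {}}" and ?N = "\<lambda>v. {t\<in>N. v \<in> B t}"
  show "sym T" using assms by (simp add: tree_dec_def tree_on_def)
  show "?Z \<noteq> {}" using assms unfolding tree_dec_def connected_in_def by blast
  fix A assume A: "A \<subseteq> ?Z" "A \<noteq> {}" "no_edge T A (?Z - A)"
  have split: "?N v \<subseteq> A \<or> ?N v \<subseteq> ?Z - A" if "v \<in> C" for v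
    using that assms A by (intro connected_in_split[of T]) (auto simp: tree_dec_def)
  let ?C1 = "{v\<in>C. ?N v \<subseteq> A}" and ?C2 = "{v\<in>C. ?N v \<subseteq> ?Z - A}"
  have "(a, b) \<notin> r \<and> (b, a) \<notin> r" if "a \<in> ?C1" "b \<in> ?C2" for a b
  proof -
    have "\<not> (\<exists>t\<in>N. a \<in> B t \<and> b \<in> B t)" using that by blast
    then show ?thesis using assms(1) unfolding tree_dec_def by blast
  qed
  then have "no_edge r ?C1 ?C2" by (simp add: no_edge_def)
  moreover have "C \<subseteq> ?C1 \<union> ?C2" using split by auto
  ultimately consider "C \<subseteq> ?C1" | "C \<subseteq> ?C2" using connected_in_split[OF assms(2)] by blast
  then show "A = ?Z"
  proof cases
    case 1
    then show ?thesis using A(1) by blast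
  next
    case 2
    then show ?thesis using A(1,2) by blast
  qed
qed

text \<open>The nodes whose bags meet \<open>C t\<close> form a subtree that avoids
  \<open>t\<close>. Touching sets have intersecting subtrees, through a common vertex or through a
  bag containing a joining edge, which \<open>tree_no_avoiding_family\<close> forbids.\<close>

lemma tree_dec_no_bramble:
  assumes "tree_dec r V N T B"
    and C: "\<And>t. t \<in> N \<Longrightarrow> connected_in r (C t) \<and> C t \<subseteq> V - B t"
    and touch: "\<And>s t. s \<in> N \<Longrightarrow> t \<in> N \<Longrightarrow> C s \<inter> C t \<noteq> {} \<or> \<not> no_edge r (C s) (C t)"
  shows False
proof (rule tree_no_avoiding_family[of N T "\<lambda>t. {s\<in>N. B s \<inter> C t \<noteq> {}}"])
  show "tree_on N T" using assms(1) by (simp add: tree_dec_def)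
  show "connected_in T {s \<in> N. B s \<inter> C t \<noteq> {}} \<and> {s \<in> N. B s \<inter> C t \<noteq> {}} \<subseteq> N \<and>
      t \<notin> {s \<in> N. B s \<inter> C t \<noteq> {}}" if "t \<in> N" for t
    using C[OF that] tree_dec_connected_nodes[OF assms(1), of "C t"] by blast
  show "{u \<in> N. B u \<inter> C s \<noteq> {}} \<inter> {u \<in> N. B u \<inter> C t \<noteq> {}} \<noteq> {}" if st: "s \<in> N" "t \<in> N" for s t
    using touch[OF st]
  proof
    assume "C s \<inter> C t \<noteq> {}"
    then obtain v where "v \<in> C s" "v \<in> C t" "v \<in> V" using C[OF st(1)] by blast
    then show ?thesis using assms(1) unfolding tree_dec_def by blast
  next
    assume "\<not> no_edge r (C s) (C t)"
    then obtain u v where uv: "u \<in> C s" "v \<in> C t" "(u, v) \<in> r \<or> (v, u) \<in> r"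
      by (auto simp: no_edge_def)
    then obtain w where "w \<in> N" "u \<in> B w" "v \<in> B w"
      using assms(1) unfolding tree_dec_def by blast
    then show ?thesis using uv by blast
  qed
qed

section \<open>A bag that balances a large vertex set\<close>

lemma card_le_Int_add:
  assumes "finite S" "X \<subseteq> S" "Y \<subseteq> S" "card X + card Y > card S"
  shows "X \<inter> Y \<noteq> {}"
proof
  assume "X \<inter> Y = {}"
  then have "card X + card Y = card (X \<union> Y)"
    using assms by (subst card_Un_disjoint) (auto intro: finite_subset)
  also have "\<dots> \<le> card S" using assms by (intro card_mono) auto
  finally show False using assms by simp
qed

text \<open>If every bag failed, each would leave a connected complement or a component with too
  large a share of \<open>S\<close>. The lower bounds on \<open>card S\<close> and
  \<open>card V\<close> are what makes any two of these sets touch.\<close>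

lemma ex_balanced_bag:
  assumes "finite V" "tree_dec r V N T B" "connected_in r V"
    and width: "\<And>t. t \<in> N \<Longrightarrow> card (B t) \<le> k + 1"
    and S: "S \<subseteq> V" "2 * k + 1 \<le> card S" "card S + 2 \<le> card V"
  shows "\<exists>t\<in>N. \<not> connected_in r (V - B t) \<and>
    (\<forall>C. component_in r (V - B t) C \<longrightarrow> card (C \<inter> S) + card (B t) \<le> card S)"
proof (rule ccontr)
  assume contra: "\<not> ?thesis"
  have finS: "finite S" using S assms(1) by (auto intro: finite_subset)
  have BV: "B t \<subseteq> V" "finite (B t)" if "t \<in> N" for t
    using assms(1,2) that by (auto simp: tree_dec_def intro: finite_subset)
  \<comment> \<open>A violating component satisfies |C \<inter> S| + |B t| > |S|; with |B t| \<le> k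
    + 1 the strictness absorbs the extra 1.\<close>
  have "\<forall>t\<in>N. \<exists>C. connected_in r C \<and> C \<subseteq> V - B t \<and> (C = V - B t \<or> card S \<le> card (C \<inter> S) + k)"
  proof
    fix t assume t: "t \<in> N"
    show "\<exists>C. connected_in r C \<and> C \<subseteq> V - B t \<and> (C = V - B t \<or> card S \<le> card (C \<inter> S) + k)"
    proof (cases "connected_in r (V - B t)")
      case False
      then obtain C where "component_in r (V - B t) C" "card (C \<inter> S) + card (B t) > card S"
        using contra t by (meson linorder_not_le)
      then show ?thesis using width[OF t] by (intro exI[of _ C]) (auto simp: component_in_def)
    qed blast
  qed
  then obtain C where C: "\<And>t. t \<in> N \<Longrightarrow> connected_in r (C t) \<and> C t \<subseteq> V - B t"
    and alt: "\<And>t. t \<in> N \<Longrightarrow> C t = V - B t \<or> card S \<le> card (C t \<inter> S) + k" by metis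
  \<comment> \<open>If a full complement \<open>V - B s\<close> does not touch \<open>C t\<close>,
    then \<open>C t\<close> lies inside \<open>B s\<close>. It has at least k + 1 \<ge> |B s|
    vertices, so it equals \<open>B s\<close>, and the connected \<open>V\<close> would fall into
    two parts without an edge between them.\<close>
  have mixed: "C s \<inter> C t \<noteq> {} \<or> \<not> no_edge r (C s) (C t)"
    if st: "s \<in> N" "t \<in> N" and Cs: "C s = V - B s" and Ct: "card S \<le> card (C t \<inter> S) + k" for s t
  proof (rule ccontr)
    assume neg: "\<not> ?thesis"
    then have "C t \<subseteq> B s" using C[OF st(2)] Cs by blast
    moreover have "card (B s) \<le> card (C t)"
    proof -
      have "card (B s) \<le> k + 1" by (rule width[OF st(1)])
      also have "\<dots> \<le> card (C t \<inter> S)" using Ct S(2) by simp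
      also have "\<dots> \<le> card (C t)"
        using \<open>C t \<subseteq> B s\<close> BV[OF st(1)] by (intro card_mono) (auto intro: finite_subset)
      finally show ?thesis .
    qed
    ultimately have "C t = B s" using BV[OF st(1)] by (simp add: card_seteq)
    then have "V \<subseteq> C s \<union> C t" using Cs by auto
    then have "V \<subseteq> C s \<or> V \<subseteq> C t" using connected_in_split[OF assms(3)] neg by blast
    then show False
      using C[OF st(1)] C[OF st(2)] neg by (auto simp: connected_in_def)
  qed
  show False
  proof (rule tree_dec_no_bramble[OF assms(2) C])
    fix s t assume st: "s \<in> N" "t \<in> N"
    consider "C s = V - B s" "C t = V - B t"
      | "C s = V - B s" "card S \<le> card (C t \<inter> S) + k"
      | "C t = V - B t" "card S \<le> card (C s \<inter> S) + k"
      | "card S \<le> card (C s \<inter> S) + k" "card S \<le> card (C t \<inter> S) + k"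
      using alt[OF st(1)] alt[OF st(2)] by blast
    then show "C s \<inter> C t \<noteq> {} \<or> \<not> no_edge r (C s) (C t)"
    proof cases
      case 1
      \<comment> \<open>Two bags have at most 2k + 2 vertices together, while |V| \<ge> |S| + 2
        \<ge> 2k + 3; some vertex lies in both complements.\<close>
      have "card (B s \<union> B t) \<le> card (B s) + card (B t)" by (rule card_Un_le)
      also have "\<dots> < card V" using width[OF st(1)] width[OF st(2)] S by simp
      finally have "\<not> V \<subseteq> B s \<union> B t" using BV st by (meson card_mono finite_UnI linorder_not_le)
      then show ?thesis using 1 by blast
    next
      case 2
      then show ?thesis by (rule mixed[OF st])
    next
      case 3
      then show ?thesis using mixed[OF st(2,1)] no_edge_sym by blast
    next
      case 4
      \<comment> \<open>Both shares of \<open>S\<close> have at least |S| - k elements, and 2(|S| -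
        k) > |S| because |S| > 2k.\<close>
      then have "(C s \<inter> S) \<inter> (C t \<inter> S) \<noteq> {}"
        using S(2) finS by (intro card_le_Int_add[of S]) auto
      then show ?thesis by blast
    qed
  qed
qed

text \<open>In each component \<open>C\<close> of \<open>V - B\<close>, deleting
  \<open>C \<inter> S\<close> leaves a subset of \<open>V - S\<close>, at a cost of at most |S| -
  |B|. All components are treated in parallel, so replacing \<open>S\<close> by \<open>B\<close>
  does not raise the total. The bound \<open>card B \<le> card S\<close> keeps the subtraction on
  \<open>nat\<close> exact.\<close>

lemma td_optimal_balanced:
  assumes "sym r" "finite V" "td_optimal r V S" "B \<subseteq> V" "card B \<le> card S"
    and bal: "\<And>C. component_in r (V - B) C \<Longrightarrow> card (C \<inter> S) + card B \<le> card S"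
  shows "td_optimal r V B"
proof -
  have S: "S \<subseteq> V" "td r V = card S + td r (V - S)" using assms by (auto simp: td_optimal_def)
  have "td_le r C (card S - card B + td r (V - S))" if "component_in r (V - B) C" for C
  proof -
    have C: "C \<subseteq> V" "finite C" using that assms(2) by (auto simp: component_in_def intro: finite_subset)
    have "td r C \<le> card (C \<inter> S) + td r (C - C \<inter> S)" using C by (intro td_le_diff) auto
    also have "\<dots> \<le> card S - card B + td r (V - S)"
      using bal[OF that] C assms(2) by (intro add_mono td_mono) auto
    finally show ?thesis using C by (simp add: td_le_iff)
  qed
  then have "td_le r (V - B) (card S - card B + td r (V - S))"
    by (rule td_le_components[OF assms(1) finite_Diff[OF assms(2)]])
  then have "td r (V - B) \<le> card S - card B + td r (V - S)"
    using assms(2) by (simp add: td_le_iff)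
  then have "card B + td r (V - B) \<le> td r V" using S assms(5) by simp
  with td_le_diff[of V B r] assms(2,4) show ?thesis by (simp add: td_optimal_def)
qed

section \<open>Small optimal minimal separators\<close>

definition separates :: "'a rel \<Rightarrow> 'a set \<Rightarrow> 'a \<Rightarrow> 'a \<Rightarrow> 'a set \<Rightarrow> bool" where
  "separates r V a b S \<longleftrightarrow> a \<in> V \<and> b \<in> V \<and> S \<subseteq> V - {a, b} \<and> (a, b) \<notin> rtrancl_on (V - S) r"

definition min_separates :: "'a rel \<Rightarrow> 'a set \<Rightarrow> 'a \<Rightarrow> 'a \<Rightarrow> 'a set \<Rightarrow> bool" where
  "min_separates r V a b S \<longleftrightarrow> separates r V a b S \<and> (\<forall>S'. S' \<subset> S \<longrightarrow> \<not> separates r V a b S')"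

text \<open>A pair that \<open>P\<close> separates is fixed; a subset of \<open>P\<close> of least
  size that still separates this pair is minimal by inclusion.\<close>

lemma ex_min_separates:
  assumes "finite P" "P \<subseteq> V" "V - P \<noteq> {}" "\<not> connected_in r (V - P)"
  obtains S a b where "S \<subseteq> P" "min_separates r V a b S"
proof -
  obtain a b where "separates r V a b P"
    using assms by (auto simp: connected_in_def separates_def)
  then obtain S where S: "S \<subseteq> P" "separates r V a b S"
    and least: "\<And>S'. S' \<subseteq> P \<Longrightarrow> separates r V a b S' \<Longrightarrow> card S \<le> card S'"
    using ex_has_least_nat[of "\<lambda>S. S \<subseteq> P \<and> separates r V a b S" P card] by auto
  have "\<not> separates r V a b S'" if "S' \<subset> S" for S'
  proof -
    have "card S' < card S" using that S(1) assms(1) by (meson finite_subset psubset_card_mono)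
    then show ?thesis using least[of S'] that S(1) by auto
  qed
  then have "S \<subseteq> P" "min_separates r V a b S"
    using S by (auto simp: min_separates_def)
  then show ?thesis by (rule that)
qed

theorem ex_small_optimal_min_separator:
  assumes "finite V" "sym r" "irrefl r"
    and ab: "a \<in> V" "b \<in> V" "a \<noteq> b" "(a, b) \<notin> r"
    and dec: "tree_dec r V N T B" and width: "\<And>t. t \<in> N \<Longrightarrow> card (B t) \<le> k + 1"
  obtains S c d where "min_separates r V c d S" "td_optimal r V S" "card S \<le> 2 * k"
proof -
  note result = that
  have small: thesis if P: "td_optimal r V P" "V - P \<noteq> {}" "\<not> connected_in r (V - P)" "card P \<le> 2 * k" for P
  proof -
    have fin: "finite P" "P \<subseteq> V" using P assms(1) by (auto simp: td_optimal_def finite_subset)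
    then obtain S c d where S: "S \<subseteq> P" "min_separates r V c d S"
      using ex_min_separates P(2,3) by metis
    then have "card S \<le> 2 * k" using P(4) fin by (meson card_mono le_trans)
    then show thesis using result S td_optimal_subset[OF assms(1) P(1) S(1)] by blast
  qed
  have "(b, a) \<notin> r" using ab(4) assms(2) by (meson symE)
  then obtain P where P: "td_optimal r V P" "V - P \<noteq> {}" "\<not> connected_in r (V - P)"
    using ex_optimal_disconnecting[OF assms(1) ab] by blast
  show thesis
  proof (cases "connected_in r V")
    case False
    \<comment> \<open>If the graph is disconnected, the empty set already disconnects it and is
      optimal.\<close>
    have "td_optimal r V {}" by (simp add: td_optimal_def)
    then show thesis using small[of "{}"] False ab(1) by auto
  next
    case True
    have finP: "finite P" "P \<subseteq> V" using P assms(1) by (auto simp: td_optimal_def finite_subset)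
    then obtain S c d where S: "S \<subseteq> P" "min_separates r V c d S"
      using ex_min_separates P(2,3) by metis
    have opt: "td_optimal r V S" by (rule td_optimal_subset[OF assms(1) P(1) S(1)])
    show thesis
    proof (cases "card S \<le> 2 * k")
      case True
      then show thesis by (rule result[OF S(2) opt])
    next
      case False
      \<comment> \<open>Here \<open>c \<noteq> d\<close> because every vertex outside
        \<open>S\<close> reaches itself. The two vertices outside \<open>S\<close> supply the margin
        |S| + 2 \<le> |V|.\<close>
      have "c \<in> V" "d \<in> V" "S \<subseteq> V - {c, d}" "c \<noteq> d"
        using S(2) by (auto simp: min_separates_def separates_def)
      then have "S \<union> {c, d} \<subseteq> V" "card (S \<union> {c, d}) = card S + 2" "S \<subseteq> V"
        using S finP by (auto simp: finite_subset card_insert_if)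
      then have cards: "S \<subseteq> V" "2 * k + 1 \<le> card S" "card S + 2 \<le> card V"
        using card_mono[OF assms(1), of "S \<union> {c, d}"] False by auto
      obtain t where t: "t \<in> N" "\<not> connected_in r (V - B t)"
        and bal: "\<And>C. component_in r (V - B t) C \<Longrightarrow> card (C \<inter> S) + card (B t) \<le> card S"
        using ex_balanced_bag[OF assms(1) dec \<open>connected_in r V\<close> width cards] by blast
      have Bt: "B t \<subseteq> V" using dec t by (auto simp: tree_dec_def)
      \<comment> \<open>A connected graph with two vertices has an edge, and the bag containing it
        has at least two elements. With k \<ge> 1 the bag bound k + 1 is at most 2k.\<close>
      have k: "k \<ge> 1"
      proof (rule ccontr)
        assume "\<not> k \<ge> 1"
        obtain u v where uv: "(u, v) \<in> r"
          using \<open>connected_in r V\<close> ab connected_in_split[of r V "{a}" "V - {a}"]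
          by (auto simp: no_edge_def)
        then have "u \<noteq> v" using assms(3) by (auto simp: irrefl_def)
        obtain s where s: "s \<in> N" "{u, v} \<subseteq> B s" using dec uv unfolding tree_dec_def by blast
        then have "finite (B s)" using dec assms(1) by (auto simp: tree_dec_def intro: finite_subset)
        then have "card {u, v} \<le> card (B s)" using s by (intro card_mono)
        then show False using width[OF s(1)] \<open>u \<noteq> v\<close> \<open>\<not> k \<ge> 1\<close> by simp
      qed
      have "card (B t) < card V" using width[OF t(1)] cards by simp
      then have "V - B t \<noteq> {}" using Bt by auto
      moreover have "card (B t) \<le> card S" "card (B t) \<le> 2 * k"
        using width[OF t(1)] cards k by auto
      ultimately show thesis
        using small[of "B t"] t(2) td_optimal_balanced[OF assms(2,1) opt Bt _ bal] by blast
    qed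
  qed
qed

section \<open>Treedepth of graphs\<close>

lemma td_le_rel_mono:
  assumes "td_le r X h" "\<And>u v. u \<in> X \<Longrightarrow> v \<in> X \<Longrightarrow> (u, v) \<in> r' \<Longrightarrow> (u, v) \<in> r"
  shows "td_le r' X h"
  using assms
proof (induction rule: td_le.induct)
  case (td_remove v X h)
  then have "td_le r' (X - {v}) h" by blast
  with td_remove.hyps(1) show ?case by (rule td_le.td_remove)
next
  case (td_split A h B)
  then have "td_le r' A h" "td_le r' B h" by blast+
  moreover have "no_edge r' A B"
    using td_split.hyps(4) td_split.prems unfolding no_edge_def by (meson UnCI)
  ultimately show ?case using td_split.hyps(3) by (intro td_le.td_split)
qed (rule td_le.td_empty)

lemma td_restrict: "td (r \<inter> X \<times> X) X = td r X"
proof -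
  have "td_le (r \<inter> X \<times> X) X h \<longleftrightarrow> td_le r X h" for h
    using td_le_rel_mono[of "r \<inter> X \<times> X" X h r] td_le_rel_mono[of r X h "r \<inter> X \<times> X"] by blast
  then show ?thesis by (simp add: td_def)
qed

text \<open>\<open>R\<close> is the parent-to-child relation of a forest whose roots are the
  vertices outside \<open>Range R\<close>. A walk of \<open>n\<close> arcs has \<open>n + 1\<close>
  vertices, so \<open>n < h\<close> bounds the height by \<open>h\<close>; it also excludes cycles,
  which could be repeated to give arbitrarily long walks.\<close>

definition forest_rel :: "'a rel \<Rightarrow> 'a set \<Rightarrow> nat \<Rightarrow> 'a rel \<Rightarrow> bool" where
  "forest_rel r X h R \<longleftrightarrow> R \<subseteq> X \<times> X \<and> single_valued (R\<inverse>) \<and>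
     (\<forall>u\<in>X. \<forall>v\<in>X. (u, v) \<in> r \<longrightarrow> (u, v) \<in> R\<^sup>* \<or> (v, u) \<in> R\<^sup>*) \<and>
     (\<forall>x\<in>X. \<exists>y\<in>X - Range R. (y, x) \<in> R\<^sup>*) \<and>
     (\<forall>x\<in>X. \<forall>y n. (x, y) \<in> R ^^ n \<longrightarrow> n < h)"

lemma relpow_avoiding:
  assumes "(x, y) \<in> S ^^ n" "x \<in> Z" "\<And>a b. a \<in> Z \<Longrightarrow> (a, b) \<in> S \<Longrightarrow> (a, b) \<in> R \<and> b \<in> Z"
  shows "(x, y) \<in> R ^^ n"
  using assms(1,2)
proof (induction n arbitrary: x)
  case (Suc n)
  then obtain w where "(x, w) \<in> S" "(w, y) \<in> S ^^ n" by (meson relpow_Suc_D2)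
  then show ?case using Suc assms(3)[of x w] by (meson relpow_Suc_I2)
qed simp

text \<open>The vertex \<open>v\<close> becomes the parent of all former roots, which lengthens
  every root path by one.\<close>

lemma forest_rel_add_root:
  assumes R: "forest_rel r (X - {v}) h R" and v: "v \<in> X"
  shows "forest_rel r X (Suc h) (R \<union> {v} \<times> (X - {v} - Range R))" (is "forest_rel _ _ _ ?S")
  unfolding forest_rel_def
proof (intro conjI)
  have RX: "R \<subseteq> (X - {v}) \<times> (X - {v})" and sv: "single_valued (R\<inverse>)"
    and edges: "\<And>u w. u \<in> X - {v} \<Longrightarrow> w \<in> X - {v} \<Longrightarrow> (u, w) \<in> r \<Longrightarrow> (u, w) \<in> R\<^sup>* \<or> (w, u) \<in> R\<^sup>*"
    and roots: "\<And>x. x \<in> X - {v} \<Longrightarrow> \<exists>y\<in>X - {v} - Range R. (y, x) \<in> R\<^sup>*"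
    and chains: "\<And>x y n. x \<in> X - {v} \<Longrightarrow> (x, y) \<in> R ^^ n \<Longrightarrow> n < h"
    using R unfolding forest_rel_def by blast+
  have mono: "R\<^sup>* \<subseteq> ?S\<^sup>*" by (rule rtrancl_mono) simp
  have top: "(v, x) \<in> ?S\<^sup>*" if x: "x \<in> X" for x
  proof (cases "x = v")
    case False
    then obtain y where "y \<in> X - {v} - Range R" "(y, x) \<in> R\<^sup>*" using roots x by blast
    then have "(v, y) \<in> ?S" "(y, x) \<in> ?S\<^sup>*" using mono by auto
    then show ?thesis by (rule converse_rtrancl_into_rtrancl)
  qed simp
  show "?S \<subseteq> X \<times> X" using RX v by auto
  show "single_valued (?S\<inverse>)" using sv by (auto simp: single_valued_def)
  show "\<forall>u\<in>X. \<forall>w\<in>X. (u, w) \<in> r \<longrightarrow> (u, w) \<in> ?S\<^sup>* \<or> (w, u) \<in> ?S\<^sup>*"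
  proof (intro ballI impI)
    fix u w assume uw: "u \<in> X" "w \<in> X" "(u, w) \<in> r"
    show "(u, w) \<in> ?S\<^sup>* \<or> (w, u) \<in> ?S\<^sup>*"
    proof (cases "u = v \<or> w = v")
      case True
      then show ?thesis using top uw by blast
    next
      case False
      then show ?thesis using edges[of u w] uw mono by blast
    qed
  qed
  have "v \<notin> Range ?S" using RX by auto
  then show "\<forall>x\<in>X. \<exists>y\<in>X - Range ?S. (y, x) \<in> ?S\<^sup>*" using top v by blast
  \<comment> \<open>Arcs that start away from \<open>v\<close> all belong to \<open>R\<close> and do
    not lead back to \<open>v\<close>, so the old height bound applies.\<close>
  have below: "n < h" if "(x, y) \<in> ?S ^^ n" "x \<in> X - {v}" for x y n
  proof -
    have "(x, y) \<in> R ^^ n"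
      using that by (rule relpow_avoiding) (use RX in auto)
    then show ?thesis using chains that(2) by blast
  qed
  show "\<forall>x\<in>X. \<forall>y n. (x, y) \<in> ?S ^^ n \<longrightarrow> n < Suc h"
  proof (intro ballI allI impI)
    fix x y n assume x: "x \<in> X" "(x, y) \<in> ?S ^^ n"
    show "n < Suc h"
    proof (cases "x = v")
      case False
      then show ?thesis using below x by (meson DiffI less_SucI singletonD)
    next
      case True
      show ?thesis
      proof (cases n)
        case (Suc m)
        then obtain w where w: "(x, w) \<in> ?S" "(w, y) \<in> ?S ^^ m" using x(2) by (meson relpow_Suc_D2)
        then have "w \<in> X - {v}" using True RX by auto
        then show ?thesis using below w(2) Suc by simp
      qed simp
    qed
  qed
qed

lemma forest_rel_Un:
  assumes R: "forest_rel r A h R" and S: "forest_rel r B h S"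
    and "A \<inter> B = {}" "no_edge r A B"
  shows "forest_rel r (A \<union> B) h (R \<union> S)"
  unfolding forest_rel_def
proof (intro conjI)
  have RA: "R \<subseteq> A \<times> A" "single_valued (R\<inverse>)"
    and SB: "S \<subseteq> B \<times> B" "single_valued (S\<inverse>)"
    using R S unfolding forest_rel_def by blast+
  have mono: "R\<^sup>* \<subseteq> (R \<union> S)\<^sup>*" "S\<^sup>* \<subseteq> (R \<union> S)\<^sup>*" by (rule rtrancl_mono, simp)+
  show "R \<union> S \<subseteq> (A \<union> B) \<times> (A \<union> B)" using RA SB by auto
  show "single_valued ((R \<union> S)\<inverse>)"
  proof (rule single_valuedI)
    fix x y z assume "(x, y) \<in> (R \<union> S)\<inverse>" "(x, z) \<in> (R \<union> S)\<inverse>"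
    then consider "(x, y) \<in> R\<inverse>" "(x, z) \<in> R\<inverse>" | "(x, y) \<in> S\<inverse>" "(x, z) \<in> S\<inverse>"
      using RA(1) SB(1) assms(3) by blast
    then show "y = z" using RA(2) SB(2) by cases (meson single_valuedD)+
  qed
  show "\<forall>u\<in>A \<union> B. \<forall>v\<in>A \<union> B. (u, v) \<in> r \<longrightarrow> (u, v) \<in> (R \<union> S)\<^sup>* \<or> (v, u) \<in> (R \<union> S)\<^sup>*"
  proof (intro ballI impI)
    fix u v assume uv: "u \<in> A \<union> B" "v \<in> A \<union> B" "(u, v) \<in> r"
    then have "u \<in> A \<and> v \<in> A \<or> u \<in> B \<and> v \<in> B" using assms(4) unfolding no_edge_def by blast
    then show "(u, v) \<in> (R \<union> S)\<^sup>* \<or> (v, u) \<in> (R \<union> S)\<^sup>*"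
      using R S uv(3) mono unfolding forest_rel_def by blast
  qed
  show "\<forall>x\<in>A \<union> B. \<exists>y\<in>A \<union> B - Range (R \<union> S). (y, x) \<in> (R \<union> S)\<^sup>*"
  proof
    fix x assume "x \<in> A \<union> B"
    then consider y where "y \<in> A - Range R" "(y, x) \<in> R\<^sup>*" | y where "y \<in> B - Range S" "(y, x) \<in> S\<^sup>*"
      using R S unfolding forest_rel_def by blast
    then show "\<exists>y\<in>A \<union> B - Range (R \<union> S). (y, x) \<in> (R \<union> S)\<^sup>*"
    proof cases
      case (1 y)
      then have "y \<in> A \<union> B - Range (R \<union> S)" "(y, x) \<in> (R \<union> S)\<^sup>*"
        using SB assms(3) mono by auto
      then show ?thesis by blast
    next
      case (2 y)
      then have "y \<in> A \<union> B - Range (R \<union> S)" "(y, x) \<in> (R \<union> S)\<^sup>*"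
        using RA assms(3) mono by auto
      then show ?thesis by blast
    qed
  qed
  show "\<forall>x\<in>A \<union> B. \<forall>y n. (x, y) \<in> (R \<union> S) ^^ n \<longrightarrow> n < h"
  proof (intro ballI allI impI)
    fix x y n assume x: "x \<in> A \<union> B" "(x, y) \<in> (R \<union> S) ^^ n"
    have "(x, y) \<in> R ^^ n" if "x \<in> A"
      using x(2) that by (rule relpow_avoiding) (use RA SB assms(3) in auto)
    moreover have "(x, y) \<in> S ^^ n" if "x \<in> B"
      using x(2) that by (rule relpow_avoiding) (use RA SB assms(3) in auto)
    ultimately show "n < h" using x(1) R S unfolding forest_rel_def by blast
  qed
qed

lemma td_le_imp_forest_rel: "td_le r X h \<Longrightarrow> \<exists>R. forest_rel r X h R"
proof (induction rule: td_le.induct)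
  case (td_empty h)
  have "forest_rel r {} h {}" by (auto simp: forest_rel_def)
  then show ?case by blast
next
  case (td_remove v X h)
  then obtain R where "forest_rel r (X - {v}) h R" by blast
  from forest_rel_add_root[OF this td_remove.hyps(1)] show ?case by (rule exI)
next
  case (td_split A h B)
  then obtain R S where "forest_rel r A h R" "forest_rel r B h S" by blast
  from forest_rel_Un[OF this td_split.hyps(3,4)] show ?case by (rule exI)
qed

section \<open>Forest relations as treedepth decompositions\<close>

lemma pcas_relpow: "pcas u p v \<Longrightarrow> set p \<subseteq> R \<Longrightarrow> (u, v) \<in> R ^^ length p"
proof (induction p arbitrary: u)
  case (Cons e p)
  then have "(u, snd e) \<in> R" by auto
  moreover have "(snd e, v) \<in> R ^^ length p" using Cons by auto
  ultimately show ?case using relpow_Suc_I2 by fastforce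
qed simp

lemma relpow_times: "(u, u) \<in> R ^^ n \<Longrightarrow> (u, u) \<in> R ^^ (k * n)"
proof (induction k)
  case (Suc k)
  then have "(u, u) \<in> R ^^ n O R ^^ (k * n)" by blast
  then show ?case by (simp add: relpow_add)
qed simp

text \<open>The empty set obeys the bound as well, since its supremum in \<open>nat\<close> is
  0.\<close>

lemma Sup_nat_le: "(\<And>n. n \<in> L \<Longrightarrow> n \<le> h) \<Longrightarrow> Sup L \<le> h" for h :: nat
  by (cases "L = {}") (auto intro: cSup_least)

lemma forest_rel_treedepth_decomposition:
  assumes "forest_rel (arcs_ends G) (verts G) h R" "wf_digraph G" "finite (verts G)"
  shows "\<exists>F. treedepth_decomposition G F \<and> forest_height F \<le> h"
proof (intro exI conjI)
  let ?X = "verts G" and ?F = "\<lparr>pverts = verts G, parcs = R\<rparr>"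
  have RX: "R \<subseteq> ?X \<times> ?X" and sv: "single_valued (R\<inverse>)"
    and edges: "\<And>u v. u \<in> ?X \<Longrightarrow> v \<in> ?X \<Longrightarrow> u \<rightarrow>\<^bsub>G\<^esub> v \<Longrightarrow> (u, v) \<in> R\<^sup>* \<or> (v, u) \<in> R\<^sup>*"
    and chains: "\<And>x y n. x \<in> ?X \<Longrightarrow> (x, y) \<in> R ^^ n \<Longrightarrow> n < h"
    using assms(1) unfolding forest_rel_def by blast+
  have finR: "finite R" using RX assms(3) by (meson finite_SigmaI finite_subset)
  have "fst e \<in> ?X" "snd e \<in> ?X" if "e \<in> R" for e using that RX by auto
  then interpret F: pair_fin_digraph ?F
    by unfold_locales (simp_all add: assms(3) finR)
  have walk: "u \<in> ?X \<and> (u, v) \<in> R ^^ length p" if "F.awalk u p v" for u p v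
    using that by (auto simp: F.awalk_def intro: pcas_relpow)
  have "\<not> F.cycle p" for p
  proof
    assume "F.cycle p"
    then obtain u where u: "F.awalk u p u" "p \<noteq> []" by (auto simp: F.cycle_def)
    \<comment> \<open>Running through a cycle \<open>h\<close> times gives a walk with at least
      \<open>h\<close> arcs.\<close>
    then have "(u, u) \<in> R ^^ (h * length p)" using walk by (blast intro: relpow_times)
    then have "h * length p < h" using chains walk[OF u(1)] by blast
    then show False using u(2) by (cases p) auto
  qed
  moreover have "in_degree (with_proj ?F) v \<le> 1" for v
  proof -
    have "finite (in_arcs (with_proj ?F) v)" by (rule F.finite_in_arcs)
    then show ?thesis using sv
      unfolding in_degree_def One_nat_def by (subst card_le_Suc0_iff_eq) (auto simp: in_arcs_def single_valued_def)
  qed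
  ultimately have "rooted_forest ?F"
    by (simp add: rooted_forest_def forest_def F.pair_fin_digraph)
  moreover have "u \<rightarrow>\<^sup>*\<^bsub>with_proj ?F\<^esub> v \<or> v \<rightarrow>\<^sup>*\<^bsub>with_proj ?F\<^esub> u" if "u \<rightarrow>\<^bsub>G\<^esub> v" for u v
  proof -
    have uv: "u \<in> ?X" "v \<in> ?X" using wf_digraph.adj_in_verts[OF assms(2) that] by auto
    then show ?thesis
      using edges[OF uv that] F.reachable_conv'[of u v] F.reachable_conv'[of v u] by auto
  qed
  ultimately show "treedepth_decomposition G ?F" by (simp add: treedepth_decomposition_def)
  show "forest_height ?F \<le> h"
  proof -
    let ?L = "{length (pre_digraph.awalk_verts (with_proj ?F) r p) | r p l.
       in_degree (with_proj ?F) r = 0 \<and> out_degree (with_proj ?F) l = 0 \<and>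
       pre_digraph.apath (with_proj ?F) r p l}"
    have "n \<le> h" if L: "n \<in> ?L" for n
    proof -
      obtain r p l where n: "n = length (pre_digraph.awalk_verts (with_proj ?F) r p)" "F.awalk r p l"
        using L unfolding F.apath_def by blast
      \<comment> \<open>Fewer than \<open>h\<close> arcs means at most \<open>h\<close>
        vertices.\<close>
      then have "length p < h" using walk chains by blast
      then show ?thesis using n(1) by (simp add: F.length_awalk_verts)
    qed
    then have "Sup ?L \<le> h" by (rule Sup_nat_le)
    then show ?thesis by (simp add: forest_height_def)
  qed
qed

section \<open>From tree-like orders to elimination bounds\<close>

lemma ex_minimal_below:
  assumes "finite V" "x \<in> V"
    and trans: "\<And>x y z. L x y \<Longrightarrow> L y z \<Longrightarrow> L x z"
    and antisym: "\<And>x y. L x y \<Longrightarrow> L y x \<Longrightarrow> x = y"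
    and refl: "\<And>x. x \<in> V \<Longrightarrow> L x x"
  shows "\<exists>m\<in>V. L m x \<and> (\<forall>y\<in>V. L y m \<longrightarrow> y = m)"
proof -
  \<comment> \<open>Among the elements below \<open>x\<close>, one with the fewest elements below it
    is minimal.\<close>
  obtain m where m: "m \<in> V" "L m x"
    and least: "\<And>y. y \<in> V \<Longrightarrow> L y x \<Longrightarrow> card {z\<in>V. L z m} \<le> card {z\<in>V. L z y}"
    using ex_has_least_nat[of "\<lambda>m. m \<in> V \<and> L m x" x "\<lambda>y. card {z\<in>V. L z y}"] assms(2) refl
    by blast
  have "y = m" if y: "y \<in> V" "L y m" for y
  proof (rule ccontr)
    assume "y \<noteq> m"
    then have "m \<notin> {z\<in>V. L z y}" using antisym y by blast
    then have "{z\<in>V. L z y} \<subset> {z\<in>V. L z m}" using m(1) refl trans y(2) by blast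
    then have "card {z\<in>V. L z y} < card {z\<in>V. L z m}" using assms(1) by (simp add: psubset_card_mono)
    then show False using least[OF y(1)] trans[OF y(2) m(2)] by simp
  qed
  with m show ?thesis by blast
qed

text \<open>\<open>L\<close> stands for the ancestor order, kept fixed while \<open>X\<close>
  shrinks. A minimal \<open>m\<close> is either below everything and can be removed as a root, or
  the elements above it have no edges to the rest and can be split off.\<close>

lemma td_le_order:
  assumes "finite X"
    and trans: "\<And>x y z. L x y \<Longrightarrow> L y z \<Longrightarrow> L x z"
    and antisym: "\<And>x y. L x y \<Longrightarrow> L y x \<Longrightarrow> x = y"
    and refl: "\<And>x. x \<in> X \<Longrightarrow> L x x"
    and chain: "\<And>x y z. L y x \<Longrightarrow> L z x \<Longrightarrow> L y z \<or> L z y"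
    and edges: "\<And>u v. (u, v) \<in> r \<Longrightarrow> L u v \<or> L v u"
    and height: "\<And>x. x \<in> X \<Longrightarrow> card {y\<in>X. L y x} \<le> h"
  shows "td_le r X h"
  using assms(1) refl height
proof (induction X arbitrary: h rule: finite_psubset_induct)
  case (psubset X)
  show ?case
  proof (cases "X = {}")
    case True
    then show ?thesis by (simp add: td_empty)
  next
    case False
    then obtain x where "x \<in> X" by blast
    with psubset.hyps(1) have "\<exists>m\<in>X. L m x \<and> (\<forall>y\<in>X. L y m \<longrightarrow> y = m)"
      by (rule ex_minimal_below) (erule (1) trans, erule (1) antisym, erule psubset.prems(1))
    then obtain m where m: "m \<in> X" "\<And>y. y \<in> X \<Longrightarrow> L y m \<Longrightarrow> y = m" by blast
    let ?D = "{v\<in>X. L m v}"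
    show ?thesis
    proof (cases "?D = X")
      case False
      have sub: "td_le r Y h" if Y: "Y \<subset> X" for Y
      proof (rule psubset.IH[OF Y])
        show "card {y\<in>Y. L y x} \<le> h" if "x \<in> Y" for x
        proof -
          have "card {y\<in>Y. L y x} \<le> card {y\<in>X. L y x}"
            using Y psubset.hyps(1) by (intro card_mono) auto
          then show ?thesis using psubset.prems(2)[of x] that Y by auto
        qed
      qed (use Y psubset.prems(1) in auto)
      have "(a, b) \<notin> r \<and> (b, a) \<notin> r" if ab: "a \<in> ?D" "b \<in> X - ?D" for a b
      proof -
        have "\<not> L a b" using ab trans by blast
        \<comment> \<open>Both \<open>m\<close> and \<open>b\<close> would be below
          \<open>a\<close>, hence comparable: either \<open>b\<close> is above \<open>m\<close>, or
          minimality gives \<open>b = m\<close>. Both put \<open>b\<close> into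
          \<open>?D\<close>.\<close>
        moreover have "\<not> L b a"
        proof
          assume "L b a"
          then have "L m b \<or> L b m" using chain ab(1) by blast
          then show False using ab m psubset.prems(1) by blast
        qed
        ultimately show ?thesis using edges by blast
      qed
      then have "no_edge r ?D (X - ?D)" by (simp add: no_edge_def)
      moreover have "td_le r ?D h" "td_le r (X - ?D) h"
        using sub[of ?D] sub[of "X - ?D"] False m(1) psubset.prems(1) by blast+
      ultimately have "td_le r (?D \<union> (X - ?D)) h" by (intro td_split) auto
      then show ?thesis by (simp add: Un_absorb1)
    next
      case True
      have "card {y\<in>X. L y m} \<ge> 1"
        using m(1) psubset.hyps(1) psubset.prems(1) by (auto simp: Suc_le_eq card_gt_0_iff)
      then obtain h' where h: "h = Suc h'" using psubset.prems(2)[OF m(1)] by (cases h) auto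
      have "td_le r (X - {m}) h'"
      proof (rule psubset.IH)
        show "card {y\<in>X - {m}. L y x} \<le> h'" if x: "x \<in> X - {m}" for x
        proof -
          \<comment> \<open>Since \<open>m\<close> lies below every \<open>x\<close>, each count
            drops by exactly one when \<open>m\<close> is removed.\<close>
          have "{y\<in>X - {m}. L y x} = {y\<in>X. L y x} - {m}" by auto
          moreover have "m \<in> {y\<in>X. L y x}" using x True m(1) by auto
          ultimately show ?thesis
            using psubset.prems(2)[of x] x h psubset.hyps(1) by (simp add: card_Diff_singleton)
        qed
      qed (use m(1) psubset.prems(1) in auto)
      with m(1) show ?thesis unfolding h by (rule td_remove)
    qed
  qed
qed

section \<open>Ancestors in a rooted forest\<close>

locale rooted_forest_digraph = pair_fin_digraph F for F :: "'a pair_pre_digraph" +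
  assumes rooted: "rooted_forest F"
begin

lemma not_reachable1_self: "(u, u) \<notin> (parcs F)\<^sup>+"
proof
  assume "(u, u) \<in> (parcs F)\<^sup>+"
  then obtain p where "awalk u p u" "p \<noteq> []" using reachable1_awalk by auto
  then have "\<exists>p. cycle p" by (intro closed_w_imp_cycle[of p]) (auto simp: closed_w_def)
  then show False using rooted by (simp add: rooted_forest_def forest_def)
qed

lemma reachable_antisym:
  assumes "u \<rightarrow>\<^sup>*\<^bsub>F\<^esub> v" "v \<rightarrow>\<^sup>*\<^bsub>F\<^esub> u"
  shows "u = v"
proof (rule ccontr)
  assume "u \<noteq> v"
  with assms(1) have "(u, v) \<in> (parcs F)\<^sup>+" by (rule reachable_neq_reachable1)
  from reachable1_reachable_trans[OF this assms(2)] show False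
    using not_reachable1_self by simp
qed

lemma parent_unique:
  assumes "(u, w) \<in> parcs F" "(v, w) \<in> parcs F"
  shows "u = v"
proof -
  have "w \<in> pverts F" using assms(1) by (rule in_arcsD2)
  then have "card (in_arcs (with_proj F) w) \<le> Suc 0"
    using rooted by (simp add: rooted_forest_def in_degree_def)
  then have "\<forall>a\<in>in_arcs (with_proj F) w. \<forall>b\<in>in_arcs (with_proj F) w. a = b"
    using card_le_Suc0_iff_eq[OF finite_in_arcs] by blast
  then have "(u, w) = (v, w)" using assms by (auto simp: in_arcs_def)
  then show ?thesis by simp
qed

lemma reachable_last_arc:
  assumes "u \<rightarrow>\<^sup>*\<^bsub>F\<^esub> v" "u \<noteq> v"
  obtains w where "u \<rightarrow>\<^sup>*\<^bsub>F\<^esub> w" "(w, v) \<in> parcs F"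
proof -
  have "(u, v) \<in> (parcs F)\<^sup>*" "u \<in> pverts F"
    using assms(1) by (auto simp: reachable_conv)
  moreover from this(1) obtain w where "(u, w) \<in> (parcs F)\<^sup>*" "(w, v) \<in> parcs F"
    using assms(2) by (auto elim: rtranclE)
  ultimately show thesis using that reachable_conv'[of u w] by blast
qed

text \<open>By induction along the walk from \<open>u\<close>: an ancestor of \<open>y\<close> other
  than \<open>y\<close> is an ancestor of the unique parent of \<open>y\<close>.\<close>

lemma ancestors_chain:
  assumes "u \<rightarrow>\<^sup>*\<^bsub>F\<^esub> x" "v \<rightarrow>\<^sup>*\<^bsub>F\<^esub> x"
  shows "u \<rightarrow>\<^sup>*\<^bsub>F\<^esub> v \<or> v \<rightarrow>\<^sup>*\<^bsub>F\<^esub> u"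
  using assms
proof (induction rule: reachable_induct)
  case (step x y)
  show ?case
  proof (cases "v = y")
    case True
    then show ?thesis using step.hyps by (blast intro: reachable_adj_trans)
  next
    case False
    then obtain w where "v \<rightarrow>\<^sup>*\<^bsub>F\<^esub> w" "(w, y) \<in> parcs F"
      using reachable_last_arc step.prems by metis
    then show ?thesis using step.IH step.hyps(2) parent_unique by metis
  qed
qed blast

text \<open>Climbing from \<open>v\<close> towards \<open>y\<close> retraces the walk, because
  parents are unique, until either \<open>y\<close> or the start \<open>u\<close> is
  reached.\<close>

lemma ancestor_on_awalk:
  assumes "awalk u p v" "y \<rightarrow>\<^sup>*\<^bsub>F\<^esub> v"
  shows "y \<in> set (awalk_verts u p) \<or> y \<rightarrow>\<^sup>*\<^bsub>F\<^esub> u"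
  using assms(1)
proof (induction p arbitrary: u)
  case Nil
  then show ?case using assms(2) by (simp add: awalk_Nil_iff)
next
  case (Cons e p)
  then have e: "(u, snd e) \<in> parcs F" "awalk (snd e) p v" "u = fst e" by (auto simp: awalk_Cons_iff)
  consider "y \<in> set (awalk_verts (snd e) p)" | "y \<rightarrow>\<^sup>*\<^bsub>F\<^esub> snd e" "y \<noteq> snd e"
    using Cons.IH[OF e(2)] hd_in_awalk_verts(1)[OF e(2)] by blast
  then show ?case
  proof cases
    case 2
    then obtain w where "y \<rightarrow>\<^sup>*\<^bsub>F\<^esub> w" "(w, snd e) \<in> parcs F" using reachable_last_arc by metis
    then show ?thesis using parent_unique e(1) by metis
  qed simp
qed

text \<open>A root \<open>m\<close> above \<open>x\<close> and a leaf \<open>l\<close> below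
  \<open>x\<close> are joined by a path, and this root-to-leaf path contains all ancestors of
  \<open>x\<close>.\<close>

lemma card_ancestors_le_height:
  assumes x: "x \<in> pverts F"
  shows "card {y\<in>pverts F. y \<rightarrow>\<^sup>*\<^bsub>F\<^esub> x} \<le> forest_height F"
proof -
  have "\<exists>m\<in>pverts F. m \<rightarrow>\<^sup>*\<^bsub>F\<^esub> x \<and> (\<forall>y\<in>pverts F. y \<rightarrow>\<^sup>*\<^bsub>F\<^esub> m \<longrightarrow> y = m)"
    using pair_finite_verts x
    by (rule ex_minimal_below) (erule (1) reachable_trans, erule (1) reachable_antisym, erule reachable_refl)
  then obtain m where m: "m \<rightarrow>\<^sup>*\<^bsub>F\<^esub> x" and mmin: "\<And>y. y \<rightarrow>\<^sup>*\<^bsub>F\<^esub> m \<Longrightarrow> y = m"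
    using reachable_in_verts(1) by blast
  have "\<exists>l\<in>pverts F. x \<rightarrow>\<^sup>*\<^bsub>F\<^esub> l \<and> (\<forall>y\<in>pverts F. l \<rightarrow>\<^sup>*\<^bsub>F\<^esub> y \<longrightarrow> y = l)"
    using pair_finite_verts x
    by (rule ex_minimal_below)
      (erule (1) reachable_trans[rotated], erule (1) reachable_antisym[rotated], erule reachable_refl)
  then obtain l where l: "x \<rightarrow>\<^sup>*\<^bsub>F\<^esub> l" and lmax: "\<And>y. l \<rightarrow>\<^sup>*\<^bsub>F\<^esub> y \<Longrightarrow> y = l"
    using reachable_in_verts(2) by blast
  have no_loop: "(y, y) \<notin> parcs F" for y using not_reachable1_self[of y] by auto
  have "(y, m) \<notin> parcs F" for y using mmin[of y] no_loop[of m] reachable_adjI[of y m] by auto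
  moreover have "(l, y) \<notin> parcs F" for y using lmax[of y] no_loop[of l] reachable_adjI[of l y] by auto
  ultimately have "in_arcs (with_proj F) m = {}" "out_arcs (with_proj F) l = {}"
    by (auto simp: in_arcs_def out_arcs_def)
  then have deg: "in_degree (with_proj F) m = 0" "out_degree (with_proj F) l = 0"
    by (simp_all add: in_degree_def out_degree_def)
  obtain p where p: "apath m p l" using reachable_trans[OF m l] reachable_apath by auto
  let ?L = "{length (awalk_verts r p) | r p l.
      in_degree (with_proj F) r = 0 \<and> out_degree (with_proj F) l = 0 \<and> apath r p l}"
  \<comment> \<open>The lengths must be bounded for \<open>Sup\<close> on \<open>nat\<close> to
    dominate the members of \<open>?L\<close>.\<close>
  have "n \<le> card (pverts F)" if n: "n \<in> ?L" for n
  proof -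
    obtain r p l where p: "n = length (awalk_verts r p)" "apath r p l" using n by blast
    show ?thesis using length_apath_less[OF p(2)] p(1) by (simp add: length_awalk_verts)
  qed
  then have "bdd_above ?L" by (rule bdd_aboveI)
  moreover have "length (awalk_verts m p) \<in> ?L" using p deg by blast
  ultimately have "length (awalk_verts m p) \<le> Sup ?L" by (intro cSup_upper)
  then have len: "length (awalk_verts m p) \<le> forest_height F"
    by (simp add: forest_height_def)
  have "{y\<in>pverts F. y \<rightarrow>\<^sup>*\<^bsub>F\<^esub> x} \<subseteq> set (awalk_verts m p)"
  proof clarify
    fix y assume "y \<rightarrow>\<^sup>*\<^bsub>F\<^esub> x"
    then have "y \<rightarrow>\<^sup>*\<^bsub>F\<^esub> l" using l by (rule reachable_trans)
    then have "y \<in> set (awalk_verts m p) \<or> y = m"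
      using ancestor_on_awalk[of m p l y] p mmin by (auto simp: apath_def)
    then show "y \<in> set (awalk_verts m p)"
      using p hd_in_awalk_verts(1)[of m p l] by (auto simp: apath_def)
  qed
  then have "card {y\<in>pverts F. y \<rightarrow>\<^sup>*\<^bsub>F\<^esub> x} \<le> card (set (awalk_verts m p))"
    by (intro card_mono) auto
  also have "\<dots> \<le> forest_height F" using card_length[of "awalk_verts m p"] len by simp
  finally show ?thesis .
qed

end

lemma treedepth_decomposition_td_le:
  assumes "treedepth_decomposition G F"
  shows "td_le (arcs_ends G) (verts G) (forest_height F)"
proof -
  have F: "rooted_forest F" "pverts F = verts G"
    and edges: "\<And>u v. u \<rightarrow>\<^bsub>G\<^esub> v \<Longrightarrow> u \<rightarrow>\<^sup>*\<^bsub>with_proj F\<^esub> v \<or> v \<rightarrow>\<^sup>*\<^bsub>with_proj F\<^esub> u"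
    using assms by (auto simp: treedepth_decomposition_def)
  then interpret rooted_forest_digraph F
    by (simp add: rooted_forest_digraph_def rooted_forest_digraph_axioms_def rooted_forest_def)
  have "td_le (arcs_ends G) (pverts F) (forest_height F)"
    using pair_finite_verts
    by (rule td_le_order[where L = "reachable (with_proj F)"])
      (erule (1) reachable_trans, erule (1) reachable_antisym, erule reachable_refl,
        erule (1) ancestors_chain, erule edges, erule card_ancestors_le_height)
  then show ?thesis by (simp add: F(2))
qed

section \<open>Treedepth of a graph and of its vertex-deleted subgraphs\<close>

lemma treedepth_eq_td:
  assumes "wf_digraph G" "finite (verts G)"
  shows "treedepth G = td (arcs_ends G) (verts G)"
  unfolding treedepth_def
proof (rule Least_equality)
  let ?t = "td (arcs_ends G) (verts G)"
  have "td_le (arcs_ends G) (verts G) ?t" using assms(2) by (simp add: td_le_iff)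
  then obtain R where "forest_rel (arcs_ends G) (verts G) ?t R" using td_le_imp_forest_rel by blast
  then obtain F where F: "treedepth_decomposition G F" "forest_height F \<le> ?t"
    using forest_rel_treedepth_decomposition assms by blast
  have lower: "?t \<le> forest_height F" if "treedepth_decomposition G F" for F
    using treedepth_decomposition_td_le[OF that] assms(2) by (simp add: td_le_iff)
  then show "\<exists>F. treedepth_decomposition G F \<and> forest_height F = ?t" using F by (meson le_antisym)
  show "?t \<le> h" if "\<exists>F. treedepth_decomposition G F \<and> forest_height F = h" for h
    using that lower by blast
qed

lemma arcs_ends_induce: "arcs_ends (G \<restriction> X) = arcs_ends G \<inter> X \<times> X"
  by (auto simp: arcs_ends_conv)

lemma treedepth_delete_verts:
  assumes "wf_digraph G" "finite (verts G)"
  shows "treedepth (delete_verts G S) = td (arcs_ends G) (verts G - S)"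
proof -
  have "wf_digraph (delete_verts G S)"
    using assms(1) unfolding delete_verts_def by (rule wf_digraph.wellformed_induce_subgraph)
  then show ?thesis
    using assms(2) by (subst treedepth_eq_td) (auto simp: delete_verts_def arcs_ends_induce td_restrict)
qed

section \<open>Separators and tree decompositions of graphs\<close>

lemma rtrancl_on_restrict: "rtrancl_on X (r \<inter> X \<times> X) = rtrancl_on X r"
proof (intro subset_antisym subrelI)
  fix u v assume "(u, v) \<in> rtrancl_on X r"
  then show "(u, v) \<in> rtrancl_on X (r \<inter> X \<times> X)"
    by (induction rule: rtrancl_on_induct) (auto intro: rtrancl_on_into_rtrancl_on)
qed (rule rtrancl_on_mono[of "r \<inter> X \<times> X"]; simp)

text \<open>With symmetric arcs, reachability in one direction gives the other, so lying in
  different strong components amounts to being unreachable within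
  \<open>verts G - S\<close>.\<close>

lemma separator_iff_separates:
  assumes "graph G"
  shows "separator G a b S \<longleftrightarrow> separates (arcs_ends G) (verts G) a b S"
proof -
  interpret G: graph G by fact
  let ?H = "G \<restriction> (verts G - S)"
  interpret H: wf_digraph ?H by (rule G.wellformed_induce_subgraph)
  have reach: "u \<rightarrow>\<^sup>*\<^bsub>?H\<^esub> v \<longleftrightarrow> (u, v) \<in> rtrancl_on (verts G - S) (arcs_ends G)" for u v
    by (simp add: reachable_def arcs_ends_induce rtrancl_on_restrict)
  have rsym: "sym (rtrancl_on (verts G - S) (arcs_ends G))"
    using G.sym_arcs by (simp add: symmetric_def rtrancl_on_sym)
  have "(\<exists>C \<in> H.sccs_verts. \<exists>D \<in> H.sccs_verts. a \<in> C \<and> b \<in> D \<and> C \<noteq> D) \<longleftrightarrow> \<not> a \<rightarrow>\<^sup>*\<^bsub>?H\<^esub> b"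
    if ab: "a \<in> verts ?H" "b \<in> verts ?H"
  proof
    assume "\<exists>C \<in> H.sccs_verts. \<exists>D \<in> H.sccs_verts. a \<in> C \<and> b \<in> D \<and> C \<noteq> D"
    then obtain C D where CD: "C \<in> H.sccs_verts" "D \<in> H.sccs_verts" "a \<in> C" "b \<in> D" "C \<noteq> D" by blast
    then have "b \<notin> C" using H.sccs_verts_disjoint by blast
    then have "\<not> a \<rightarrow>\<^sup>*\<^bsub>?H\<^esub> b \<or> \<not> b \<rightarrow>\<^sup>*\<^bsub>?H\<^esub> a"
      using CD(1,3) by (auto simp: H.in_sccs_verts_conv_reachable)
    then show "\<not> a \<rightarrow>\<^sup>*\<^bsub>?H\<^esub> b" using reach rsym by (auto dest: symD)
  next
    assume "\<not> a \<rightarrow>\<^sup>*\<^bsub>?H\<^esub> b"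
    then have "H.scc_of a \<noteq> H.scc_of b"
      using H.in_scc_of_self[OF ab(2)] by (auto simp: H.scc_of_def)
    then show "\<exists>C \<in> H.sccs_verts. \<exists>D \<in> H.sccs_verts. a \<in> C \<and> b \<in> D \<and> C \<noteq> D"
      using H.scc_of_in_sccs_verts H.in_scc_of_self ab by blast
  qed
  then show ?thesis
    unfolding separator_def separates_def delete_verts_def reach by auto
qed

lemma minimal_ab_separator_iff:
  assumes "graph G"
  shows "minimal_ab_separator G a b S \<longleftrightarrow> min_separates (arcs_ends G) (verts G) a b S"
  by (simp add: minimal_ab_separator_def min_separates_def separator_iff_separates[OF assms])

section \<open>Tree decompositions of graphs in relational form\<close>

lemma connected_imp_connected_in:
  assumes "connected G" "sym (arcs_ends G)"
  shows "connected_in (arcs_ends G) (verts G)"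
proof -
  \<comment> \<open>\<open>connected\<close> refers to the symmetric closure, which adds nothing to
    a symmetric relation.\<close>
  have "parcs (mk_symmetric G) \<subseteq> arcs_ends G"
    using assms(2) by (auto simp: mk_symmetric_def arcs_ends_conv sym_def)
  then show ?thesis
    using assms(1) rtrancl_on_mono[of "parcs (mk_symmetric G)" "arcs_ends G" "verts G" "verts G"]
    by (auto simp: connected_def strongly_connected_def connected_in_def reachable_def mk_symmetric_def)
qed

text \<open>If an edge were not a bridge, a path between its ends that avoids it would close up with
  the edge to a cycle of length at least 3.\<close>

lemma undirected_tree_tree_on:
  assumes "undirected_tree T"
  shows "tree_on (pverts T) (parcs T)"
proof -
  interpret T: pair_graph T using assms by (simp add: undirected_tree_def)
  have symT: "sym (parcs T)" using T.pair_sym_arcs by (simp add: symmetric_def)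
  have "t \<notin> side (pverts T) (parcs T) s t" if st: "(s, t) \<in> parcs T" for s t
  proof
    assume "t \<in> side (pverts T) (parcs T) s t"
    define H where "H = \<lparr>pverts = pverts T, parcs = parcs T - {(s, t), (t, s)}\<rparr>"
    interpret H: pair_wf_digraph H
      by unfold_locales (auto simp: H_def T.arc_fst_in_verts T.arc_snd_in_verts)
    have "s \<rightarrow>\<^sup>*\<^bsub>with_proj H\<^esub> t"
      using \<open>t \<in> side _ _ s t\<close> by (simp add: reachable_def side_def H_def)
    then obtain p where p: "H.apath s p t" using H.reachable_apath by auto
    have "s \<noteq> t" using st T.no_loops' by blast
    have "p \<noteq> []" using p \<open>s \<noteq> t\<close> by (auto simp: H.apath_Nil_iff)
    \<comment> \<open>A path from \<open>s\<close> to \<open>t\<close> with one arc would be the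
      deleted arc itself, so \<open>p\<close> has at least two arcs and the cycle formed with
      \<open>(t, s)\<close> at least three.\<close>
    moreover have "p \<noteq> [e]" for e
    proof
      assume "p = [e]"
      then have "e \<in> parcs H" "e = (s, t)"
        using p by (auto simp: H.apath_Cons_iff H.apath_Nil_iff prod_eq_iff)
      then show False by (simp add: H_def)
    qed
    ultimately have len: "2 \<le> length p" by (cases p; cases "tl p") auto
    have pT: "T.awalk s p t" "distinct (pawalk_verts s p)"
    proof -
      have "pverts H = pverts T" "parcs H \<subseteq> parcs T" by (auto simp: H_def)
      then show "T.awalk s p t" "distinct (pawalk_verts s p)"
        using p by (auto simp: H.apath_def H.awalk_def T.awalk_def)
    qed
    have ts: "(t, s) \<in> parcs T" using st symT by (meson symE)
    with pT(1) have "T.awalk t ((t, s) # p) t" by (simp add: T.awalk_Cons_iff)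
    then have "T.cycle ((t, s) # p)" using pT(2) by (auto simp: T.cycle_def)
    then show False using assms len by (auto simp: undirected_tree_def)
  qed
  moreover have "connected_in (parcs T) (pverts T)"
    using assms connected_imp_connected_in[of "with_proj T"] symT by (simp add: undirected_tree_def)
  ultimately show ?thesis
    using symT T.pair_finite_verts T.in_arcsD1 T.in_arcsD2 by (auto simp: tree_on_def)
qed

lemma connected_in_rel_mono:
  assumes "connected_in r X" "r \<subseteq> r'"
  shows "connected_in r' X"
  using assms rtrancl_on_mono[OF assms(2) order_refl] by (auto simp: connected_in_def)

lemma tree_decomposition_tree_dec:
  assumes "tree_decomposition G T B"
  shows "tree_dec (arcs_ends G) (verts G) (pverts T) (parcs T) B"
proof -
  have T: "undirected_tree T" "(\<Union>t\<in>pverts T. B t) = verts G"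
    and edges: "\<And>u v. u \<rightarrow>\<^bsub>G\<^esub> v \<Longrightarrow> \<exists>t\<in>pverts T. u \<in> B t \<and> v \<in> B t"
    and conn: "\<And>v. v \<in> verts G \<Longrightarrow> connected (with_proj T \<restriction> {t \<in> pverts T. v \<in> B t})"
    using assms by (auto simp: tree_decomposition_def)
  have tree: "tree_on (pverts T) (parcs T)" using T(1) by (rule undirected_tree_tree_on)
  have "connected_in (parcs T) {t \<in> pverts T. v \<in> B t}" if v: "v \<in> verts G" for v
  proof (rule connected_in_rel_mono)
    let ?H = "with_proj T \<restriction> {t \<in> pverts T. v \<in> B t}"
    have "sym (arcs_ends ?H)" using tree by (auto simp: arcs_ends_induce tree_on_def sym_def)
    from connected_imp_connected_in[OF conn[OF v] this]
    show "connected_in (arcs_ends ?H) {t \<in> pverts T. v \<in> B t}" by simp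
    show "arcs_ends ?H \<subseteq> parcs T" by (auto simp: arcs_ends_induce)
  qed
  then show ?thesis using tree T(2) edges by (auto simp: tree_dec_def)
qed

text \<open>One node whose bag holds all vertices suffices. Existence is what makes the
  \<open>LEAST\<close> in \<open>treewidth\<close> an attained value.\<close>

lemma ex_tree_decomposition:
  assumes "wf_digraph G"
  shows "\<exists>T B. tree_decomposition G T B"
proof (intro exI)
  let ?T = "\<lparr>pverts = {0::nat}, parcs = {}\<rparr>" and ?B = "\<lambda>_::nat. verts G"
  interpret T: pair_graph ?T by unfold_locales (auto simp: symmetric_def sym_def)
  have conn: "connected (with_proj ?T)" "connected (with_proj ?T \<restriction> {0})"
    by (auto simp: connected_def strongly_connected_def mk_symmetric_def reachable_def)
  have "\<not> T.cycle p" for p by (cases p) (auto simp: T.cycle_def T.awalk_def)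
  then have "undirected_tree ?T"
    using T.pair_graph conn(1) by (simp add: undirected_tree_def)
  then show "tree_decomposition G ?T ?B"
    using conn(2) wf_digraph.adj_in_verts[OF assms] by (auto simp: tree_decomposition_def)
qed

lemma ex_tree_dec_treewidth:
  assumes "wf_digraph G"
  obtains N :: "nat set" and T B where "tree_dec (arcs_ends G) (verts G) N T B"
    and "\<And>t. t \<in> N \<Longrightarrow> card (B t) \<le> treewidth G + 1"
proof -
  have "\<exists>w T B. tree_decomposition G T B \<and> decomposition_width T B = w"
    using ex_tree_decomposition[OF assms] by blast
  then have "\<exists>T B. tree_decomposition G T B \<and> decomposition_width T B = treewidth G"
    unfolding treewidth_def by (rule LeastI_ex)
  then obtain T B where TB: "tree_decomposition G T B" "decomposition_width T B = treewidth G" by blast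
  have dec: "tree_dec (arcs_ends G) (verts G) (pverts T) (parcs T) B"
    by (rule tree_decomposition_tree_dec[OF TB(1)])
  then have "finite (pverts T)" by (simp add: tree_dec_def tree_on_def)
  then have "card (B t) \<le> Max ((\<lambda>t. card (B t)) ` pverts T)" if "t \<in> pverts T" for t
    using that by (intro Max_ge) auto
  \<comment> \<open>The inequality M \<le> (M - 1) + 1 also holds for truncated subtraction, so
    empty bags cause no exception.\<close>
  then have "card (B t) \<le> treewidth G + 1" if "t \<in> pverts T" for t
    using that TB(2) unfolding decomposition_width_def by fastforce
  with dec show thesis by (rule that)
qed

theorem theorem2:
  fixes G :: "('a, 'b) pre_digraph"
  assumes "graph G" and "\<not> complete_graph G"
  shows "\<exists>S \<in> optimal_minimal_separators G. card S \<le> 2 * treewidth G"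
proof -
  interpret G: graph G by fact
  let ?V = "verts G" and ?r = "arcs_ends G"
  have r: "sym ?r" "irrefl ?r" "?r \<subseteq> ?V \<times> ?V"
    using G.sym_arcs G.adj_not_same G.adj_in_verts by (auto simp: symmetric_def irrefl_def)
  \<comment> \<open>The number \<open>n\<close> in \<open>complete_graph\<close> can be taken as the
    number of vertices, so non-completeness means that the arcs are not all pairs of distinct
    vertices. This yields the non-adjacent pair.\<close>
  have "?r \<noteq> {(u, v). (u, v) \<in> ?V \<times> ?V \<and> u \<noteq> v}"
    using assms by (simp add: complete_graph_def complete_digraph_def)
  then obtain a b where ab: "a \<in> ?V" "b \<in> ?V" "a \<noteq> b" "(a, b) \<notin> ?r"
    using r(2,3) unfolding irrefl_def by fast
  obtain N :: "nat set" and T B where dec: "tree_dec ?r ?V N T B"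
    and width: "\<And>t. t \<in> N \<Longrightarrow> card (B t) \<le> treewidth G + 1"
    using ex_tree_dec_treewidth[OF G.wf_digraph] by blast
  obtain S c d where S: "min_separates ?r ?V c d S" "td_optimal ?r ?V S" "card S \<le> 2 * treewidth G"
    using ex_small_optimal_min_separator[OF G.finite_verts r(1,2) ab dec width] by blast
  have "minimal_ab_separator G c d S" using S(1) by (simp add: minimal_ab_separator_iff[OF assms(1)])
  moreover have "c \<in> ?V" "d \<in> ?V" using S(1) by (simp_all add: min_separates_def separates_def)
  ultimately have "S \<in> minimal_separators G" by (auto simp: minimal_separators_def)
  moreover have "treedepth G = card S + treedepth (delete_verts G S)"
    using S(2) treedepth_eq_td[OF G.wf_digraph G.finite_verts]
      treedepth_delete_verts[OF G.wf_digraph G.finite_verts] by (simp add: td_optimal_def)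
  ultimately show ?thesis using S(3) by (auto simp: optimal_minimal_separators_def)
qed

end
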